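(* Let $\mathcal V$ be a finite set, $r\in\mathcal V$, $\mathcal V'=\mathcal V\setminus\{r\}$, and let $\mathcal P$ be a partition of $\mathcal V'$ into $k\geq 1$ non-empty parts. Let $\mathcal T(\mathcal V,\mathcal P)$ be the set of all finite $r$-rooted hypertrees with vertex set $\mathcal V$ and Prüfer partition $\mathcal P$. Then there exists a bijection $\Phi:\mathcal T(\mathcal V,\mathcal P)\to\mathcal V^{k-1}$ onto the set of words of length $k-1$ over the alphabet $\mathcal V$ such that for every $T\in\mathcal T(\mathcal V,\mathcal P)$ and every non-root vertex $v\in\mathcal V'$, the number of occurrences of the letter $v$ in $\Phi(T)$ equals $\deg_T(v)-1$; moreover $\Phi$ is given by an algorithm whose running time is polynomial in $|\mathcal V|$.
   Context: A hypergraph $(\mathcal V,\mathcal E)$ has vertex set $\mathcal V$ and hyperedges which are subsets of $\mathcal V$ with at least two elements; $\deg_T(v)$ is the number of hyperedges containing $v$. Distinct vertices in a common hyperedge are adjacent; connectedness and distance are defined via paths of consecutively adjacent vertices. A finite connected hypergraph with $n$ vertices and $k$ hyperedges is a finite hypertree if $\sum_e |e| = n+k-1$. An $r$-rooted hypertree has a marked root vertex $r$; each hyperedge $e$ has a unique vertex $e_*$ closest to $r$, and $e'=e\setminus\{e_*\}$ is its reduced hyperedge. The reduced hyperedges form a partition of $\mathcal V\setminus\{r\}$, called the Prüfer partition of the rooted hypertree; it has exactly as many parts as there are hyperedges. *)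

theory Defs
  imports "HOL-Library.Disjoint_Sets" "HOL-Computational_Algebra.Polynomial"
begin

definition hypergraph :: "'a set \<Rightarrow> 'a set set \<Rightarrow> bool" where
  "hypergraph V E \<longleftrightarrow> (\<forall>e\<in>E. e \<subseteq> V \<and> (\<exists>u\<in>e. \<exists>v\<in>e. u \<noteq> v))"

definition hdegree :: "'a set set \<Rightarrow> 'a \<Rightarrow> nat" where
  "hdegree E v = card {e \<in> E. v \<in> e}"

definition adjacent :: "'a set set \<Rightarrow> 'a \<Rightarrow> 'a \<Rightarrow> bool" where
  "adjacent E u v \<longleftrightarrow> u \<noteq> v \<and> (\<exists>e\<in>E. u \<in> e \<and> v \<in> e)"

definition path_between :: "'a set \<Rightarrow> 'a set set \<Rightarrow> 'a \<Rightarrow> 'a \<Rightarrow> 'a list \<Rightarrow> bool" where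
  "path_between V E u v p \<longleftrightarrow>
     p \<noteq> [] \<and> set p \<subseteq> V \<and> hd p = u \<and> last p = v \<and> successively (adjacent E) p"

definition connected_hypergraph :: "'a set \<Rightarrow> 'a set set \<Rightarrow> bool" where
  "connected_hypergraph V E \<longleftrightarrow>
     hypergraph V E \<and> (\<forall>u\<in>V. \<forall>v\<in>V. \<exists>p. path_between V E u v p)"

definition distance :: "'a set \<Rightarrow> 'a set set \<Rightarrow> 'a \<Rightarrow> 'a \<Rightarrow> nat" where
  "distance V E u v = (LEAST d. \<exists>p. path_between V E u v p \<and> length p = d + 1)"

definition finite_hypertree :: "'a set \<Rightarrow> 'a set set \<Rightarrow> bool" where
  "finite_hypertree V E \<longleftrightarrow>
     finite V \<and> connected_hypergraph V E \<and>
     int (\<Sum>e\<in>E. card e) = int (card V) + int (card E) - 1"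

definition closest :: "'a set \<Rightarrow> 'a set set \<Rightarrow> 'a \<Rightarrow> 'a set \<Rightarrow> 'a" where
  "closest V E r e = (THE v. v \<in> e \<and> (\<forall>u\<in>e. distance V E r v \<le> distance V E r u))"

definition reduced :: "'a set \<Rightarrow> 'a set set \<Rightarrow> 'a \<Rightarrow> 'a set \<Rightarrow> 'a set" where
  "reduced V E r e = e - {closest V E r e}"

definition pruefer_partition :: "'a set \<Rightarrow> 'a set set \<Rightarrow> 'a \<Rightarrow> 'a set set" where
  "pruefer_partition V E r = reduced V E r ` E"

text \<open>A rooted hypertree on a given vertex set with a given root is represented by its set of
  hyperedges.\<close>

definition rooted_hypertrees :: "'a set \<Rightarrow> 'a \<Rightarrow> 'a set set \<Rightarrow> 'a set set set" where
  "rooted_hypertrees V r P =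
     {E. finite_hypertree V E \<and> r \<in> V \<and> pruefer_partition V E r = P}"

definition words :: "'a set \<Rightarrow> nat \<Rightarrow> 'a list set" where
  "words V m = {w. set w \<subseteq> V \<and> length w = m}"

text \<open>Algorithms are programs of a unit-cost random access machine, written in structured form.
  The memory consists of finitely many named arrays (those occurring in the program) of natural
  numbers; a scalar variable is an array of which only one cell is used.  The arithmetic is
  addition and truncated subtraction.  There is deliberately no multiplication: bit lengths can
  grow by at most a constant in each command, so that the unit-cost measure is polynomially
  related to the running time of a Turing machine.\<close>

datatype aexp =
    Const nat
  | Cell string aexp
  | Plus aexp aexp
  | Minus aexp aexp

datatype bexp =
    Less aexp aexp
  | Equal aexp aexp
  | Neg bexp
  | Conj bexp bexp

datatype com =
    Skip
  | Assign string aexp aexp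
  | Seq com com
  | Cond bexp com com
  | While bexp com

type_synonym memory = "string \<Rightarrow> nat \<Rightarrow> nat"

primrec aval :: "aexp \<Rightarrow> memory \<Rightarrow> nat" where
  "aval (Const n) s = n"
| "aval (Cell x a) s = s x (aval a s)"
| "aval (Plus a b) s = aval a s + aval b s"
| "aval (Minus a b) s = aval a s - aval b s"

primrec bval :: "bexp \<Rightarrow> memory \<Rightarrow> bool" where
  "bval (Less a b) s \<longleftrightarrow> aval a s < aval b s"
| "bval (Equal a b) s \<longleftrightarrow> aval a s = aval b s"
| "bval (Neg b) s \<longleftrightarrow> \<not> bval b s"
| "bval (Conj b c) s \<longleftrightarrow> bval b s \<and> bval c s"

primrec acost :: "aexp \<Rightarrow> nat" where
  "acost (Const n) = 1"
| "acost (Cell x a) = acost a + 1"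
| "acost (Plus a b) = acost a + acost b + 1"
| "acost (Minus a b) = acost a + acost b + 1"

primrec bcost :: "bexp \<Rightarrow> nat" where
  "bcost (Less a b) = acost a + acost b + 1"
| "bcost (Equal a b) = acost a + acost b + 1"
| "bcost (Neg b) = bcost b + 1"
| "bcost (Conj b c) = bcost b + bcost c + 1"

text \<open>\<open>exec c s t s'\<close>: started in memory \<open>s\<close>, the program \<open>c\<close> halts after \<open>t\<close> steps in memory
  \<open>s'\<close>.  The command \<open>Assign x a b\<close> stores the value of \<open>b\<close> in the cell of the array \<open>x\<close> whose
  index is the value of \<open>a\<close>.\<close>

inductive exec :: "com \<Rightarrow> memory \<Rightarrow> nat \<Rightarrow> memory \<Rightarrow> bool" where
  Skip: "exec Skip s 1 s"
| Assign: "exec (Assign x a b) s (acost a + acost b + 1) (s(x := (s x)(aval a s := aval b s)))"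
| Seq: "exec c1 s1 t1 s2 \<Longrightarrow> exec c2 s2 t2 s3 \<Longrightarrow> exec (Seq c1 c2) s1 (t1 + t2) s3"
| CondTrue: "bval b s \<Longrightarrow> exec c1 s t s' \<Longrightarrow> exec (Cond b c1 c2) s (bcost b + 1 + t) s'"
| CondFalse: "\<not> bval b s \<Longrightarrow> exec c2 s t s' \<Longrightarrow> exec (Cond b c1 c2) s (bcost b + 1 + t) s'"
| WhileFalse: "\<not> bval b s \<Longrightarrow> exec (While b c) s (bcost b + 1) s"
| WhileTrue: "bval b s1 \<Longrightarrow> exec c s1 t1 s2 \<Longrightarrow> exec (While b c) s2 t2 s3 \<Longrightarrow>
    exec (While b c) s1 (bcost b + 1 + t1 + t2) s3"

text \<open>Inputs and outputs are lists of natural numbers.  An array holds a list if its cell 0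
  contains the length and the following cells contain the entries.\<close>

definition initial_memory :: "nat list \<Rightarrow> memory" where
  "initial_memory xs = (\<lambda>x i. if x = ''input'' \<and> i \<le> length xs then (length xs # xs) ! i else 0)"

definition holds_list :: "(nat \<Rightarrow> nat) \<Rightarrow> nat list \<Rightarrow> bool" where
  "holds_list A xs \<longleftrightarrow> A 0 = length xs \<and> (\<forall>i < length xs. A (i + 1) = xs ! i)"

definition outputs_within :: "com \<Rightarrow> nat list \<Rightarrow> nat list \<Rightarrow> nat \<Rightarrow> bool" where
  "outputs_within c xs ys b \<longleftrightarrow>
     (\<exists>t s. exec c (initial_memory xs) t s \<and> t \<le> b \<and> holds_list (s ''output'') ys)"

text \<open>The vertices are presented to a program through a numbering \<open>l\<close> of the \<open>n\<close> vertices by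
  \<open>0, \<dots>, n - 1\<close>, the hyperedges through a list \<open>es\<close>; the input consists of the number of
  vertices, the root, the number of hyperedges, and the incidence matrix, one row for each
  hyperedge.\<close>

definition encode_hypertree :: "('a \<Rightarrow> nat) \<Rightarrow> nat \<Rightarrow> 'a \<Rightarrow> 'a set list \<Rightarrow> nat list" where
  "encode_hypertree l n r es =
     [n, l r, length es] @
     concat (map (\<lambda>e. map (\<lambda>i. if i \<in> l ` e then 1 else 0) [0..<n]) es)"

text \<open>The output must not depend on the order in which the hyperedges are listed.\<close>

definition computes_within ::
  "com \<Rightarrow> 'a set \<Rightarrow> 'a \<Rightarrow> ('a \<Rightarrow> nat) \<Rightarrow> 'a set set set \<Rightarrow> ('a set set \<Rightarrow> 'a list) \<Rightarrow> nat \<Rightarrow> bool" where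
  "computes_within c V r l \<T> \<Phi> b \<longleftrightarrow>
     (\<forall>E\<in>\<T>. \<forall>es. distinct es \<and> set es = E \<longrightarrow>
        outputs_within c (encode_hypertree l (card V) r es) (map l (\<Phi> E)) b)"

end

theory Submission
  imports Defs
begin

text \<open>Orienting every hyperedge away from the root turns the hypertrees with Pruefer partition \<open>P\<close>
  into the maps \<open>f\<close> from \<open>P\<close> to the vertices along which some height function decreases: the
  hyperedge belonging to the part \<open>p\<close> is \<open>insert (f p) p\<close>.  Uniqueness of the closest vertex
  comes from counting: assign to every non-root vertex a hyperedge in which it has a strictly closer
  neighbour; a hyperedge \<open>e\<close> is assigned to at most \<open>card e - 1\<close> vertices, and the sum condition
  forces equality everywhere.  As in the classical Pruefer code, one then repeatedly removes a leaf
  (a part that contains no \<open>f p\<close>), choosing the one with the largest vertex number, and records its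
  parent.  The leaves are the parts without a letter in the code, so the code can be inverted step
  by step.  The last parent is always the root and is not recorded.

  The program works on the incidence matrix and never computes a distance: if every vertex is given
  its number of hyperedges, plus one for the root, then a hyperedge is a leaf if and only if exactly
  one of its vertices has degree other than one, and this vertex is its parent.\<close>

section \<open>The Pruefer code of a parent map\<close>

text \<open>Acyclicity is expressed by a height: passing repeatedly from a vertex to the parent of
  its part strictly lowers \<open>h\<close>, so this can only end at \<open>r\<close>. The
  extensional function space makes a map determined by its values on \<open>A\<close>, as the
  bijections require.\<close>

definition parent_maps :: "'a \<Rightarrow> 'a set set \<Rightarrow> ('a set \<Rightarrow> 'a) set" where
  "parent_maps r A =
     {f \<in> A \<rightarrow>\<^sub>E insert r (\<Union>A). \<exists>h :: 'a \<Rightarrow> nat. \<forall>p\<in>A. \<forall>v\<in>p. h (f p) < h v}"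

definition attach :: "'a set set \<Rightarrow> ('a set \<Rightarrow> 'a) \<Rightarrow> 'a set set" where
  "attach A f = (\<lambda>p. insert (f p) p) ` A"

definition leaves :: "('a set \<Rightarrow> 'a) \<Rightarrow> 'a set set \<Rightarrow> 'a set set" where
  "leaves f A = {p \<in> A. \<forall>q\<in>A. f q \<notin> p}"

definition top_part :: "('b \<Rightarrow> nat) \<Rightarrow> 'b set \<Rightarrow> 'b" where
  "top_part key L = (THE p. p \<in> L \<and> (\<forall>q\<in>L. key q \<le> key p))"

text \<open>The number of letters is a separate argument because it is used with
  \<open>card A = Suc m\<close>: the last remaining part is never processed, and its parent can only
  be \<open>r\<close>.\<close>

primrec code :: "('a set \<Rightarrow> nat) \<Rightarrow> ('a set \<Rightarrow> 'a) \<Rightarrow> 'a set set \<Rightarrow> nat \<Rightarrow> 'a list" where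
  "code key f A 0 = []"
| "code key f A (Suc m) =
     (let p = top_part key (leaves f A) in f p # code key f (A - {p}) m)"

section \<open>Largest keys, leaves, and removal of a leaf\<close>

lemma top_part_eqI:
  assumes "inj_on key L" "p \<in> L" "\<And>q. q \<in> L \<Longrightarrow> key q \<le> key p"
  shows "top_part key L = p"
  unfolding top_part_def
proof (rule the_equality)
  fix p' assume "p' \<in> L \<and> (\<forall>q\<in>L. key q \<le> key p')"
  then show "p' = p" using assms by (meson inj_onD le_antisym)
qed (use assms in blast)

lemma top_part_in:
  assumes "inj_on key L" "finite L" "L \<noteq> {}"
  shows "top_part key L \<in> L"
proof -
  have "Max (key ` L) \<in> key ` L" using assms by simp
  then obtain p where p: "p \<in> L" "key p = Max (key ` L)" by auto
  then have "top_part key L = p" using assms by (intro top_part_eqI) auto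
  with p show ?thesis by simp
qed

lemma top_part_max:
  assumes "inj_on key L" "finite L" "q \<in> L"
  shows "key q \<le> key (top_part key L)"
proof -
  have "Max (key ` L) \<in> key ` L" using assms by (intro Max_in) auto
  then obtain p where p: "p \<in> L" "key p = Max (key ` L)" by auto
  then have "top_part key L = p" using assms by (intro top_part_eqI) auto
  with p assms show ?thesis by simp
qed

text \<open>A part whose parent has maximal height is a leaf, since a parent lying inside it would
  be higher still.\<close>

lemma leaves_nonempty:
  assumes "f \<in> parent_maps r A" "finite A" "A \<noteq> {}"
  shows "leaves f A \<noteq> {}"
proof -
  obtain h :: "'a \<Rightarrow> nat" where h: "\<And>p v. p \<in> A \<Longrightarrow> v \<in> p \<Longrightarrow> h (f p) < h v"
    using assms by (auto simp: parent_maps_def)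
  have "Max ((\<lambda>p. h (f p)) ` A) \<in> (\<lambda>p. h (f p)) ` A" using assms by simp
  then obtain p where p: "p \<in> A" "h (f p) = Max ((\<lambda>p. h (f p)) ` A)" by auto
  have "f q \<notin> p" if "q \<in> A" for q
  proof
    assume "f q \<in> p"
    then have "h (f p) < h (f q)" using h p by blast
    moreover have "h (f q) \<le> h (f p)" using that assms p by simp
    ultimately show False by simp
  qed
  with p show ?thesis by (auto simp: leaves_def)
qed

lemma parent_not_in: "f \<in> parent_maps r A \<Longrightarrow> p \<in> A \<Longrightarrow> f p \<notin> p"
  by (auto simp: parent_maps_def)

lemma parent_in: "f \<in> parent_maps r A \<Longrightarrow> p \<in> A \<Longrightarrow> f p \<in> insert r (\<Union>A)"
  by (auto simp: parent_maps_def)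

lemma leaves_cong: "(\<And>p. p \<in> A \<Longrightarrow> f p = g p) \<Longrightarrow> leaves f A = leaves g A"
  by (auto simp: leaves_def)

text \<open>No parent lies in a leaf, so the other parents survive its removal; the same height
  still works.\<close>

lemma restrict_parent_maps:
  assumes f: "f \<in> parent_maps r A" and p: "p \<in> leaves f A"
  shows "restrict f (A - {p}) \<in> parent_maps r (A - {p})"
proof -
  have "f q \<in> insert r (\<Union>(A - {p}))" if "q \<in> A - {p}" for q
    using parent_in[OF f, of q] p that by (auto simp: leaves_def)
  moreover obtain h :: "'a \<Rightarrow> nat" where "\<forall>p\<in>A. \<forall>v\<in>p. h (f p) < h v"
    using f by (auto simp: parent_maps_def)
  ultimately show ?thesis by (auto simp: parent_maps_def intro!: exI[of _ h])
qed

text \<open>\<open>code\<close> hands on \<open>f\<close> unchanged while \<open>A\<close> shrinks,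
  but \<open>parent_maps\<close> demands extensionality on the smaller family. This lemma allows
  \<open>f\<close> to be exchanged for its restriction.\<close>

lemma code_cong:
  assumes "finite A" "card A = Suc m" "inj_on key A" "f \<in> parent_maps r A"
    and "\<And>p. p \<in> A \<Longrightarrow> f p = g p"
  shows "code key f A m = code key g A m"
  using assms
proof (induction m arbitrary: A f g)
  case (Suc m)
  let ?p = "top_part key (leaves f A)"
  have "inj_on key (leaves f A)" "finite (leaves f A)"
    using Suc.prems by (auto simp: leaves_def intro: inj_on_subset)
  then have p: "?p \<in> leaves f A"
    using leaves_nonempty[OF Suc.prems(4)] Suc.prems top_part_in by fastforce
  then have pA: "?p \<in> A" by (simp add: leaves_def)
  have A: "finite (A - {?p})" "card (A - {?p}) = Suc m" "inj_on key (A - {?p})"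
    using Suc.prems pA by (auto intro: inj_on_diff)
  note r = restrict_parent_maps[OF Suc.prems(4) p]
  \<comment> \<open>Both \<open>f\<close> and \<open>g\<close> are compared with the restriction of
    \<open>f\<close>, because the induction hypothesis needs a map known to be a parent map of
    \<open>A - {?p}\<close>.\<close>
  have "code key (restrict f (A - {?p})) (A - {?p}) m = code key g (A - {?p}) m"
    by (rule Suc.IH[OF A r]) (simp add: Suc.prems(5))
  moreover have "code key (restrict f (A - {?p})) (A - {?p}) m = code key f (A - {?p}) m"
    by (rule Suc.IH[OF A r]) simp
  moreover have "leaves f A = leaves g A" using Suc.prems(5) by (rule leaves_cong)
  ultimately show ?case using pA Suc.prems(5) by (simp add: Let_def)
qed simp

text \<open>One unfolding of \<open>code\<close>, stated with the restricted map so that inductions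
  over parent maps apply to the tail.\<close>

lemma code_step:
  assumes "finite A" "card A = Suc (Suc m)" "inj_on key A" "f \<in> parent_maps r A"
    and "p = top_part key (leaves f A)"
  shows "p \<in> leaves f A" "p \<in> A" "card (A - {p}) = Suc m"
    "restrict f (A - {p}) \<in> parent_maps r (A - {p})"
    "code key f A (Suc m) = f p # code key (restrict f (A - {p})) (A - {p}) m"
proof -
  have "inj_on key (leaves f A)" "finite (leaves f A)"
    using assms by (auto simp: leaves_def intro: inj_on_subset)
  then show p: "p \<in> leaves f A"
    using leaves_nonempty[OF assms(4)] assms top_part_in by fastforce
  then show pA: "p \<in> A" by (simp add: leaves_def)
  then show c: "card (A - {p}) = Suc m" using assms by simp
  show r: "restrict f (A - {p}) \<in> parent_maps r (A - {p})"
    by (rule restrict_parent_maps[OF assms(4) p])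
  have "code key (restrict f (A - {p})) (A - {p}) m = code key f (A - {p}) m"
    by (rule code_cong[OF _ c _ r]) (use assms in \<open>auto intro: inj_on_diff\<close>)
  then show "code key f A (Suc m) = f p # code key (restrict f (A - {p})) (A - {p}) m"
    using assms(5) by (simp add: Let_def)
qed

section \<open>What the letters of a code reveal\<close>

lemma code_in_words:
  assumes "finite A" "card A = Suc m" "inj_on key A" "f \<in> parent_maps r A"
  shows "code key f A m \<in> words (insert r (\<Union>A)) m"
  using assms
proof (induction m arbitrary: A f)
  case (Suc m)
  define p where "p = top_part key (leaves f A)"
  note s = code_step[OF Suc.prems p_def]
  have "code key (restrict f (A - {p})) (A - {p}) m \<in> words (insert r (\<Union>(A - {p}))) m"
    using Suc.prems by (intro Suc.IH s) (auto intro: inj_on_diff)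
  then show ?case
    using parent_in[OF Suc.prems(4) s(2)] unfolding s(5) words_def by auto
qed (simp add: words_def)

text \<open>Every part contributes its parent once, when it is removed. Only the last part
  contributes nothing; its parent is \<open>r\<close>, so the counts of all other vertices are
  exact.\<close>

lemma count_code:
  assumes "finite A" "card A = Suc m" "inj_on key A" "f \<in> parent_maps r A"
    "disjoint A" "r \<notin> \<Union>A" "v \<in> \<Union>A"
  shows "count_list (code key f A m) v = card {q \<in> A. f q = v}"
  using assms
proof (induction m arbitrary: A f)
  case 0
  then obtain p where "A = {p}" by (auto simp: card_Suc_eq)
  with 0 have "{q \<in> A. f q = v} = {}"
    using parent_in[OF 0(4), of p] parent_not_in[OF 0(4), of p] by auto
  then show ?case by (simp only: code.simps card.empty count_list.simps)
next
  case (Suc m)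
  define p where "p = top_part key (leaves f A)"
  note s = code_step[OF Suc.prems(1-4) p_def]
  let ?B = "A - {p}" and ?g = "restrict f (A - {p})"
  have B: "finite ?B" "inj_on key ?B" "disjoint ?B" "r \<notin> \<Union>?B"
    using Suc.prems by (auto intro: inj_on_diff simp: pairwise_def)
  have D: "{q \<in> A. f q = v} = (if f p = v then insert p else id) {q \<in> ?B. ?g q = v}"
    using s(2) by auto
  show ?case
  proof (cases "v \<in> p")
    case True
    then have e: "{q \<in> A. f q = v} = {}" using s(1) by (auto simp: leaves_def)
    \<comment> \<open>By disjointness, removing \<open>p\<close> takes \<open>v\<close> out of the
      alphabet of the remaining code.\<close>
    have "v \<notin> insert r (\<Union>?B)"
      using True Suc.prems s(2) by (auto dest: disjointD)
    then have "v \<notin> set (code key ?g ?B m)"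
      using code_in_words[OF B(1) s(3) B(2) s(4)] by (auto simp: words_def)
    moreover have "f p \<noteq> v" using e s(2) by auto
    ultimately show ?thesis unfolding e s(5) by (simp add: count_list_0_iff)
  next
    case False
    then have "v \<in> \<Union>?B" using Suc.prems by auto
    then have "count_list (code key ?g ?B m) v = card {q \<in> ?B. ?g q = v}"
      by (rule Suc.IH[OF B(1) s(3) B(2) s(4) B(3,4)])
    then show ?thesis unfolding s(5) D using B(1) by (simp del: restrict_apply)
  qed
qed

text \<open>The decoding rule: by \<open>count_code\<close> the non-root letters of the word are
  exactly the non-root parents, so the leaves depend on the word alone.\<close>

lemma leaves_eq_code:
  assumes "finite A" "card A = Suc m" "inj_on key A" "f \<in> parent_maps r A"
    "disjoint A" "r \<notin> \<Union>A"
  shows "leaves f A = {p \<in> A. p \<inter> set (code key f A m) = {}}"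
proof -
  have "(\<forall>q\<in>A. f q \<notin> p) \<longleftrightarrow> p \<inter> set (code key f A m) = {}" if "p \<in> A" for p
  proof -
    have "v \<in> set (code key f A m) \<longleftrightarrow> (\<exists>q\<in>A. f q = v)" if "v \<in> p" for v
    proof -
      have "v \<in> \<Union>A" using that \<open>p \<in> A\<close> by blast
      from count_code[OF assms this]
      have "count_list (code key f A m) v = 0 \<longleftrightarrow> {q \<in> A. f q = v} = {}"
        using assms(1) by simp
      then show ?thesis unfolding count_list_0_iff by blast
    qed
    then show ?thesis by blast
  qed
  then show ?thesis by (auto simp: leaves_def)
qed

section \<open>Decoding words\<close>

lemma free_part_exists:
  assumes "finite A" "disjoint A" "length w < card A"
  shows "{p \<in> A. p \<inter> set w = {}} \<noteq> {}"
proof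
  assume "{p \<in> A. p \<inter> set w = {}} = {}"
  then have "\<forall>p\<in>A. \<exists>v. v \<in> p \<and> v \<in> set w" by blast
  \<comment> \<open>Pigeonhole: one letter chosen from every part would inject the disjoint parts
    into the letters of \<open>w\<close>.\<close>
  then obtain g where g: "\<And>p. p \<in> A \<Longrightarrow> g p \<in> p \<and> g p \<in> set w" by metis
  have "inj_on g A" using g assms(2) by (metis disjointD disjoint_iff inj_onI)
  then have "card A \<le> card (set w)" using g by (intro card_inj_on_le) auto
  also have "\<dots> \<le> length w" by (rule card_length)
  finally show False using assms by simp
qed

text \<open>Induction on the number of parts. The word determines the first leaf, which gives
  injectivity. For surjectivity the part of largest key without a letter becomes the first leaf: the
  tail is decoded on the other parts, and this part is attached to the first letter.\<close>

lemma bij_code: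
  assumes "finite A" "card A = Suc m" "inj_on key A" "disjoint A" "r \<notin> \<Union>A"
  shows "bij_betw (\<lambda>f. code key f A m) (parent_maps r A) (words (insert r (\<Union>A)) m)"
  using assms
proof (induction m arbitrary: A)
  case 0
  then obtain p where A: "A = {p}" by (auto simp: card_Suc_eq)
  have "f = g" if "f \<in> parent_maps r A" "g \<in> parent_maps r A" for f g
  proof (rule PiE_ext[of f A "\<lambda>_. insert r (\<Union>A)" g])
    show "f x = g x" if "x \<in> A" for x
      using that \<open>f \<in> _\<close> \<open>g \<in> _\<close> parent_in[of _ r A p] parent_not_in[of _ r A p] A by auto
  qed (use that in \<open>auto simp: parent_maps_def\<close>)
  moreover have "(\<lambda>x\<in>A. r) \<in> parent_maps r A"
    using 0 A by (auto simp: parent_maps_def intro!: exI[of _ "\<lambda>v. if v = r then 0 else 1"])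
  ultimately show ?case by (auto simp: bij_betw_def inj_on_def words_def)
next
  case (Suc m)
  have B: "finite (A - {p})" "inj_on key (A - {p})" "disjoint (A - {p})" "r \<notin> \<Union>(A - {p})" for p
    using Suc.prems by (auto intro: inj_on_diff simp: pairwise_def)
  note cw = code_in_words[OF Suc.prems(1-3)]
  note le = leaves_eq_code[OF Suc.prems(1-3) _ Suc.prems(4-5)]
  show ?case
  proof (rule bij_betw_imageI)
    show "inj_on (\<lambda>f. code key f A (Suc m)) (parent_maps r A)"
    proof (rule inj_onI)
      fix f g assume f: "f \<in> parent_maps r A" and g: "g \<in> parent_maps r A"
        and e: "code key f A (Suc m) = code key g A (Suc m)"
      define p where "p = top_part key (leaves f A)"
      \<comment> \<open>The same word leaves the same parts free, so both maps lose the same part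
        first.\<close>
      have "leaves f A = leaves g A" using le[OF f] le[OF g] e by simp
      then have p': "p = top_part key (leaves g A)" by (simp add: p_def)
      note sf = code_step[OF Suc.prems(1-3) f p_def]
      note sg = code_step[OF Suc.prems(1-3) g p']
      have c: "f p = g p" "code key (restrict f (A - {p})) (A - {p}) m =
          code key (restrict g (A - {p})) (A - {p}) m"
        using e unfolding sf(5) sg(5) by auto
      from Suc.IH[OF B(1) sf(3) B(2-4)] sf(4) sg(4) c(2)
      have r: "restrict f (A - {p}) = restrict g (A - {p})"
        by (auto simp: bij_betw_def dest: inj_onD)
      show "f = g"
      proof (rule PiE_ext[of f A "\<lambda>_. insert r (\<Union>A)" g])
        show "f x = g x" if "x \<in> A" for x
          using c(1) fun_cong[OF r, of x] that by (auto simp: restrict_def split: if_splits)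
      qed (use f g in \<open>auto simp: parent_maps_def\<close>)
    qed
    have "w \<in> (\<lambda>f. code key f A (Suc m)) ` parent_maps r A"
      if w: "w \<in> words (insert r (\<Union>A)) (Suc m)" for w
    proof -
      \<comment> \<open>The set of leaves that \<open>leaves_eq_code\<close> predicts for any map
        with code \<open>w\<close>.\<close>
      define L where "L = {p \<in> A. p \<inter> set w = {}}"
      define p where "p = top_part key L"
      have "inj_on key L" using Suc.prems by (auto simp: L_def intro: inj_on_subset)
      moreover have "L \<noteq> {}" unfolding L_def
        using w Suc.prems by (intro free_part_exists) (auto simp: words_def)
      ultimately have "p \<in> L" unfolding p_def
        using Suc.prems by (intro top_part_in) (auto simp: L_def)
      then have p: "p \<in> A" "p \<inter> set w = {}" by (auto simp: L_def)
      let ?B = "A - {p}"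
      have cB: "card ?B = Suc m" using p Suc.prems by simp
      obtain v w' where w': "w = v # w'" "length w' = m" using w by (cases w) (auto simp: words_def)
      have v: "v \<in> insert r (\<Union>?B)" "w' \<in> words (insert r (\<Union>?B)) m"
        using w p w' by (auto simp: words_def)
      then obtain g where g: "g \<in> parent_maps r ?B" "w' = code key g ?B m"
        using Suc.IH[OF B(1) cB B(2-4)] by (auto simp: bij_betw_def)
      define f where "f = g(p := v)"
      from g obtain h :: "'a \<Rightarrow> nat" where h: "\<And>q u. q \<in> ?B \<Longrightarrow> u \<in> q \<Longrightarrow> h (g q) < h u"
        by (auto simp: parent_maps_def)
      \<comment> \<open>The new part is placed just above its parent \<open>v\<close>. No parent and
        no other part meets \<open>p\<close>, so the remaining inequalities are those of
        \<open>h\<close>.\<close>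
      define h' where "h' u = (if u \<in> p then Suc (h v) else h u)" for u
      have np: "u \<notin> p" if "u \<in> insert r (\<Union>?B)" for u
        using that p(1) Suc.prems by (auto dest: disjointD)
      have hf: "h' (f q) < h' u" if "q \<in> A" "u \<in> q" for q u
      proof (cases "q = p")
        case True
        then show ?thesis using that np[OF v(1)] by (simp add: h'_def f_def)
      next
        case False
        then have "q \<in> ?B" using that by simp
        then have "u \<notin> p" "g q \<notin> p"
          using that np parent_in[OF g(1), of q] by auto
        then show ?thesis using h[OF \<open>q \<in> ?B\<close> that(2)] False by (simp add: h'_def f_def)
      qed
      have gu: "g q = undefined" if "q \<notin> ?B" for q
        using g(1) that by (auto simp: parent_maps_def intro: PiE_arb)
      have "f \<in> A \<rightarrow>\<^sub>E insert r (\<Union>A)"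
      proof (rule PiE_I)
        show "f q \<in> insert r (\<Union>A)" if "q \<in> A" for q
          using v(1) parent_in[OF g(1), of q] that by (auto simp: f_def)
      qed (use gu p(1) in \<open>auto simp: f_def\<close>)
      then have f: "f \<in> parent_maps r A" using hf unfolding parent_maps_def by blast
      have lg: "q \<in> ?B \<Longrightarrow> (\<forall>q'\<in>?B. g q' \<notin> q) \<longleftrightarrow> q \<inter> set w' = {}" for q
        using leaves_eq_code[OF B(1) cB B(2) g(1) B(3,4)] g(2) unfolding leaves_def by blast
      \<comment> \<open>This ensures that encoding \<open>f\<close> removes \<open>p\<close> first
        and then continues with \<open>g\<close>.\<close>
      have "leaves f A = L"
      proof -
        have "(\<forall>q'\<in>A. f q' \<notin> q) \<longleftrightarrow> q \<inter> set w = {}" if "q \<in> A" for q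
        proof (cases "q = p")
          case True
          then show ?thesis using np v(1) parent_in[OF g(1)] p by (auto simp: f_def)
        next
          case False
          then have "(\<forall>q'\<in>A. f q' \<notin> q) \<longleftrightarrow> v \<notin> q \<and> (\<forall>q'\<in>?B. g q' \<notin> q)"
            using p(1) by (auto simp: f_def)
          then show ?thesis using lg[of q] that False w' by auto
        qed
        then show ?thesis by (auto simp: leaves_def L_def)
      qed
      then have p': "p = top_part key (leaves f A)" by (simp add: p_def)
      note s = code_step[OF Suc.prems(1-3) f p']
      have rg: "restrict f ?B = g"
      proof (rule ext)
        show "restrict f ?B q = g q" for q
          using gu[of q] by (cases "q \<in> ?B") (simp_all add: f_def)
      qed
      have "code key f A (Suc m) = f p # w'" unfolding s(5) rg g(2) ..
      also have "\<dots> = w" by (simp add: f_def w')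
      finally have "code key f A (Suc m) = w" .
      with f show ?thesis by blast
    qed
    then show "(\<lambda>f. code key f A (Suc m)) ` parent_maps r A = words (insert r (\<Union>A)) (Suc m)"
      using cw by blast
  qed
qed

section \<open>Hypertrees and parent maps\<close>

lemma path_between_snoc:
  assumes "path_between V E u v p" "w \<in> V" "adjacent E v w"
  shows "path_between V E u w (p @ [w])"
  using assms by (auto simp: path_between_def successively_append_iff)

lemma distance_le:
  assumes "path_between V E u v p"
  shows "distance V E u v \<le> length p - 1"
  unfolding distance_def
  using assms by (intro Least_le exI[of _ p]) (auto simp: path_between_def)

text \<open>The last vertex but one on a shortest path from \<open>r\<close> to \<open>v\<close> is
  adjacent to \<open>v\<close> and strictly closer.\<close>

lemma closer_neighbour:
  assumes "connected_hypergraph V E" "r \<in> V" "v \<in> V" "v \<noteq> r"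
  shows "\<exists>e\<in>E. v \<in> e \<and> (\<exists>u\<in>e. distance V E r u < distance V E r v)"
proof -
  let ?P = "\<lambda>d. \<exists>p. path_between V E r v p \<and> length p = d + 1"
  obtain p where "path_between V E r v p"
    using assms by (auto simp: connected_hypergraph_def)
  then have "?P (length p - 1)" by (auto simp: path_between_def intro!: exI[of _ p])
  then have "?P (distance V E r v)" unfolding distance_def by (rule LeastI)
  then obtain p where p: "path_between V E r v p" "length p = distance V E r v + 1" by blast
  then obtain q where q: "p = q @ [v]" by (cases p rule: rev_cases) (auto simp: path_between_def)
  have "q \<noteq> []" using p q assms(4) by (auto simp: path_between_def)
  then have "path_between V E r (last q) q" "adjacent E (last q) v"
    using p q by (auto simp: path_between_def successively_append_iff)
  moreover have "length q - 1 < distance V E r v" using p q \<open>q \<noteq> []\<close> by (cases q) auto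
  ultimately have "distance V E r (last q) < distance V E r v" "adjacent E (last q) v"
    using distance_le[of V E r "last q" q] by auto
  then show ?thesis unfolding adjacent_def by blast
qed

section \<open>From hypertrees to parent maps\<close>

lemma hyperedge_finite: "hypergraph V E \<Longrightarrow> finite V \<Longrightarrow> e \<in> E \<Longrightarrow> finite e"
  by (auto simp: hypergraph_def intro: finite_subset)

lemma hyperedge_card:
  assumes "hypergraph V E" "finite V" "e \<in> E"
  shows "2 \<le> card e"
proof -
  obtain u v where "u \<in> e" "v \<in> e" "u \<noteq> v" using assms by (auto simp: hypergraph_def)
  then have "card {u, v} \<le> card e"
    using hyperedge_finite[OF assms] by (intro card_mono) auto
  then show ?thesis using \<open>u \<noteq> v\<close> by simp
qed

text \<open>Here \<open>g\<close> assigns to a non-root vertex a hyperedge in which it has a closer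
  neighbour. Describing the reduced hyperedges as fibres of \<open>g\<close> gives at once that they
  are disjoint and cover the non-root vertices.\<close>

lemma hypertree_reduced:
  assumes T: "finite_hypertree V E" and r: "r \<in> V"
  obtains g where "\<And>e. e \<in> E \<Longrightarrow> reduced V E r e = {v \<in> V - {r}. g v = e}"
    "\<And>v. v \<in> V - {r} \<Longrightarrow> g v \<in> E"
    "\<And>e. e \<in> E \<Longrightarrow> closest V E r e \<in> e"
    "\<And>e u. e \<in> E \<Longrightarrow> u \<in> reduced V E r e \<Longrightarrow>
       distance V E r (closest V E r e) < distance V E r u"
proof -
  let ?d = "distance V E r"
  have fV: "finite V" and con: "connected_hypergraph V E" and hyp: "hypergraph V E"
    and sum: "int (\<Sum>e\<in>E. card e) = int (card V) + int (card E) - 1"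
    using T by (auto simp: finite_hypertree_def connected_hypergraph_def)
  have "E \<subseteq> Pow V" using hyp by (auto simp: hypergraph_def)
  then have fE: "finite E" using fV by (auto intro: finite_subset)
  have "\<forall>v\<in>V - {r}. \<exists>e\<in>E. v \<in> e \<and> (\<exists>u\<in>e. ?d u < ?d v)"
    using closer_neighbour[OF con r] by blast
  then obtain g where g: "\<And>v. v \<in> V - {r} \<Longrightarrow> g v \<in> E \<and> v \<in> g v \<and> (\<exists>u\<in>g v. ?d u < ?d v)"
    by metis
  define F where "F e = {v \<in> V - {r}. g v = e}" for e
  \<comment> \<open>A vertex of minimal distance in \<open>e\<close> has no closer neighbour there
    and is not assigned to \<open>e\<close>.\<close>
  have sub: "F e \<subseteq> e - {m}" if "\<forall>u\<in>e. ?d m \<le> ?d u" for e m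
    using g that by (fastforce simp: F_def)
  have min_ex: "\<exists>m\<in>e. \<forall>u\<in>e. ?d m \<le> ?d u" if "e \<in> E" for e
  proof -
    have "e \<noteq> {}" using hyperedge_card[OF hyp fV that] by auto
    then show ?thesis using ex_has_least_nat[of "\<lambda>x. x \<in> e" _ ?d] by blast
  qed
  have le: "card (F e) \<le> card e - 1" if e: "e \<in> E" for e
  proof -
    obtain m where m: "m \<in> e" "\<forall>u\<in>e. ?d m \<le> ?d u" using min_ex[OF e] by blast
    have "card (F e) \<le> card (e - {m})"
      using sub[OF m(2)] hyperedge_finite[OF hyp fV e] by (intro card_mono) auto
    then show ?thesis using m hyperedge_finite[OF hyp fV e] by simp
  qed
  have "(\<Sum>e\<in>E. card (F e)) = (\<Sum>e\<in>E. \<Sum>v\<in>F e. 1)" by simp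
  also have "\<dots> = (\<Sum>v\<in>V - {r}. 1)" unfolding F_def
    using g fV fE by (intro sum.group) auto
  finally have s1: "(\<Sum>e\<in>E. card (F e)) = card V - 1" using r by simp
  have "(\<Sum>e\<in>E. card e) = (\<Sum>e\<in>E. (card e - 1) + 1)"
    using hyperedge_card[OF hyp fV] by (intro sum.cong) force+
  also have "\<dots> = (\<Sum>e\<in>E. card e - 1) + card E" by (simp only: sum.distrib) simp
  finally have "(\<Sum>e\<in>E. card e - 1) = card V - 1" using sum by arith
  \<comment> \<open>The two sides of \<open>le\<close> have the same sum over \<open>E\<close>, so
    no single inequality is strict.\<close>
  with s1 have eq: "card (F e) = card e - 1" if "e \<in> E" for e
    using sum_mono_inv[of "\<lambda>e. card (F e)" E "\<lambda>e. card e - 1" e] le fE that by simp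
  have Fe: "F e = e - {m}" if e: "e \<in> E" "m \<in> e" "\<forall>u\<in>e. ?d m \<le> ?d u" for e m
    using sub[OF e(3)] eq[OF e(1)] e hyperedge_finite[OF hyp fV e(1)]
    by (intro card_subset_eq) auto
  \<comment> \<open>By \<open>Fe\<close>, two minimising vertices \<open>m\<close> and
    \<open>m'\<close> would give \<open>e - {m} = e - {m'}\<close>; hence the minimum is unique and
    the definite description is meaningful.\<close>
  have cl: "closest V E r e \<in> e \<and> (\<forall>u\<in>e. ?d (closest V E r e) \<le> ?d u)" if e: "e \<in> E" for e
    unfolding closest_def
  proof (rule theI')
    show "\<exists>!v. v \<in> e \<and> (\<forall>u\<in>e. ?d v \<le> ?d u)"
      using min_ex[OF e] Fe[OF e] by blast
  qed
  have red: "reduced V E r e = F e" if "e \<in> E" for e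
    using Fe[OF that, of "closest V E r e"] cl[OF that] unfolding reduced_def by blast
  show thesis
  proof (rule that)
    show "reduced V E r e = {v \<in> V - {r}. g v = e}" if "e \<in> E" for e
      using red[OF that] by (simp add: F_def)
    show "?d (closest V E r e) < ?d u" if "e \<in> E" "u \<in> reduced V E r e" for e u
    proof -
      have u: "u \<in> V - {r}" "g u = e" using that red by (auto simp: F_def)
      then obtain u' where "u' \<in> e" "?d u' < ?d u" using g by blast
      then show ?thesis using cl[OF that(1)] by (meson le_less_trans)
    qed
  qed (use g cl in auto)
qed

text \<open>The parent of a part is the closest vertex of the hyperedge it comes from, and the
  distance from the root serves as height.\<close>

lemma attach_parents:
  assumes T: "E \<in> rooted_hypertrees V r P"
  shows "\<exists>f\<in>parent_maps r P. attach P f = E"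
proof -
  have E: "finite_hypertree V E" "r \<in> V" "reduced V E r ` E = P"
    using T by (auto simp: rooted_hypertrees_def pruefer_partition_def)
  have hyp: "hypergraph V E" using E by (auto simp: finite_hypertree_def connected_hypergraph_def)
  obtain g where g: "\<And>e. e \<in> E \<Longrightarrow> reduced V E r e = {v \<in> V - {r}. g v = e}"
    "\<And>v. v \<in> V - {r} \<Longrightarrow> g v \<in> E"
    "\<And>e. e \<in> E \<Longrightarrow> closest V E r e \<in> e"
    "\<And>e u. e \<in> E \<Longrightarrow> u \<in> reduced V E r e \<Longrightarrow>
       distance V E r (closest V E r e) < distance V E r u"
    using hypertree_reduced[OF E(1,2)] by blast
  have ne: "reduced V E r e \<noteq> {}" if e: "e \<in> E" for e
  proof -
    obtain u v where "u \<in> e" "v \<in> e" "u \<noteq> v" using e hyp unfolding hypergraph_def by blast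
    then show ?thesis by (auto simp: reduced_def)
  qed
  \<comment> \<open>Reduced hyperedges are nonempty fibres of one function, so a common element
    identifies the hyperedge.\<close>
  have inj: "inj_on (reduced V E r) E"
  proof (rule inj_onI)
    fix e e' assume e: "e \<in> E" "e' \<in> E" "reduced V E r e = reduced V E r e'"
    obtain v where v: "v \<in> reduced V E r e" using ne[OF e(1)] by blast
    then have "v \<in> reduced V E r e'" using e(3) by simp
    with v show "e = e'" unfolding g(1)[OF e(1)] g(1)[OF e(2)] by simp
  qed
  define k where "k = inv_into E (reduced V E r)"
  have k: "k p \<in> E" "reduced V E r (k p) = p" if "p \<in> P" for p
    using that E(3) by (auto simp: k_def inv_into_into f_inv_into_f)
  have k': "k (reduced V E r e) = e" if "e \<in> E" for e
    using inj that by (simp add: k_def)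
  have UP: "\<Union>P = V - {r}"
  proof
    show "\<Union>P \<subseteq> V - {r}" unfolding E(3)[symmetric] using g(1) by blast
    show "V - {r} \<subseteq> \<Union>P" unfolding E(3)[symmetric] using g(1,2) by blast
  qed
  define f where "f = (\<lambda>p\<in>P. closest V E r (k p))"
  have edge: "insert (f p) p = k p" if "p \<in> P" for p
    using k[OF that] g(3)[OF k(1)[OF that]] that by (auto simp: f_def reduced_def)
  have "f \<in> parent_maps r P" unfolding parent_maps_def
  proof (intro CollectI conjI exI[of _ "distance V E r"] ballI)
    show "f \<in> P \<rightarrow>\<^sub>E insert r (\<Union>P)"
    proof (rule PiE_I)
      show "f p \<in> insert r (\<Union>P)" if "p \<in> P" for p
        using UP g(3)[OF k(1)[OF that]] k(1)[OF that] hyp that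
        by (auto simp: f_def hypergraph_def)
    qed (simp add: f_def)
    show "distance V E r (f p) < distance V E r v" if "p \<in> P" "v \<in> p" for p v
      using g(4)[of "k p" v] k that by (simp add: f_def)
  qed
  moreover have "attach P f = k ` P" using edge by (simp add: attach_def)
  moreover have "k ` P = E"
  proof
    show "k ` P \<subseteq> E" using k(1) by blast
    show "E \<subseteq> k ` P" using k' unfolding E(3)[symmetric] by (metis imageI subsetI)
  qed
  ultimately show ?thesis by blast
qed

section \<open>From parent maps to hypertrees\<close>

lemma inj_on_attach_edge:
  assumes f: "f \<in> parent_maps r P" and P: "disjoint P" "{} \<notin> P"
  shows "inj_on (\<lambda>p. insert (f p) p) P"
proof (rule inj_onI, rule ccontr)
  fix p q assume pq: "p \<in> P" "q \<in> P" "insert (f p) p = insert (f q) q" "p \<noteq> q"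
  obtain h :: "'a \<Rightarrow> nat" where h: "\<And>p v. p \<in> P \<Longrightarrow> v \<in> p \<Longrightarrow> h (f p) < h v"
    using f by (auto simp: parent_maps_def)
  have "p \<inter> q = {}" using P pq by (auto dest: disjointD)
  moreover obtain x y where x: "x \<in> p" and y: "y \<in> q"
    using P(2) pq(1,2) by (metis ex_in_conv)
  moreover have "x \<in> insert (f q) q" "y \<in> insert (f p) p"
    using x y pq(3) by (metis insertCI)+
  \<comment> \<open>Each parent lies in the other part, so the height would have to drop in both
    directions.\<close>
  ultimately have "f q \<in> p" "f p \<in> q" by auto
  then have "h (f p) < h (f q)" "h (f q) < h (f p)" using h pq(1,2) by blast+
  then show False by simp
qed

text \<open>By induction on the height every vertex is reached from \<open>r\<close> through the
  parent of its part; two arbitrary vertices are joined through \<open>r\<close>.\<close>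

lemma attach_connected:
  assumes f: "f \<in> parent_maps r P" and V: "insert r (\<Union>P) = V" and P: "{} \<notin> P"
  shows "connected_hypergraph V (attach P f)"
proof -
  let ?E = "attach P f"
  obtain h :: "'a \<Rightarrow> nat" where h: "\<And>p v. p \<in> P \<Longrightarrow> v \<in> p \<Longrightarrow> h (f p) < h v"
    using f by (auto simp: parent_maps_def)
  have hyp: "hypergraph V ?E" unfolding hypergraph_def attach_def
  proof (intro ballI, elim imageE, intro conjI)
    fix e p assume p: "p \<in> P" "e = insert (f p) p"
    show "e \<subseteq> V" using p parent_in[OF f p(1)] V by auto
    obtain v where "v \<in> p" using P p by (metis ex_in_conv)
    then show "\<exists>u\<in>e. \<exists>v\<in>e. u \<noteq> v" using p parent_not_in[OF f p(1)]
      by (intro bexI[of _ "f p"] bexI[of _ v]) auto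
  qed
  have from_root: "\<exists>p. path_between V ?E r v p" if "v \<in> V" for v
    using that
  proof (induction "h v" arbitrary: v rule: less_induct)
    case less
    show ?case
    proof (cases "v = r")
      case True
      then show ?thesis using less.prems
        by (intro exI[of _ "[r]"]) (simp add: path_between_def)
    next
      case False
      then obtain q where q: "q \<in> P" "v \<in> q" using less.prems V by auto
      then obtain p where "path_between V ?E r (f q) p"
        using less.hyps[OF h[OF q]] parent_in[OF f q(1)] V by blast
      moreover have "adjacent ?E (f q) v"
        using q parent_not_in[OF f q(1)] by (auto simp: adjacent_def attach_def)
      ultimately show ?thesis using path_between_snoc less.prems by metis
    qed
  qed
  have "\<exists>p. path_between V ?E u v p" if uv: "u \<in> V" "v \<in> V" for u v
  proof -
    obtain p q where p: "path_between V ?E r u p" and q: "path_between V ?E r v q"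
      using from_root uv by blast
    have sym: "(\<lambda>x y. adjacent ?E y x) = adjacent ?E" by (auto simp: adjacent_def fun_eq_iff)
    have "successively (adjacent ?E) (rev p)"
      unfolding successively_rev sym using p by (simp add: path_between_def)
    then have p': "path_between V ?E u r (rev p)"
      using p by (simp add: path_between_def hd_rev last_rev del: successively_rev)
    obtain q' where q': "q = r # q'" using q by (cases q) (auto simp: path_between_def)
    \<comment> \<open>\<open>rev p\<close> already ends in \<open>r\<close>, so the leading
      \<open>r\<close> of \<open>q\<close> is dropped.\<close>
    have "path_between V ?E u v (rev p @ q')"
    proof (cases q')
      case Nil
      then show ?thesis using p' q q' by (simp add: path_between_def)
    next
      case (Cons a list)
      then show ?thesis using p' q q' by (simp add: path_between_def successively_append_iff del: successively_rev)
    qed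
    then show ?thesis ..
  qed
  with hyp show ?thesis by (simp add: connected_hypergraph_def)
qed

text \<open>Each hyperedge has one vertex more than its part, and the parts have
  \<open>card V - 1\<close> vertices in total; this is the required sum.\<close>

lemma attach_hypertree:
  assumes f: "f \<in> parent_maps r P" and fV: "finite V" "r \<in> V" and P: "partition_on (V - {r}) P"
  shows "finite_hypertree V (attach P f)"
proof -
  have dj: "disjoint P" "{} \<notin> P" "\<Union>P = V - {r}" using P by (auto simp: partition_on_def)
  have fP: "finite P" using P fV finite_elements by blast
  have fp: "finite p" if "p \<in> P" for p using that dj(3) fV by (metis Sup_upper finite_Diff finite_subset)
  note inj = inj_on_attach_edge[OF f dj(1,2)]
  have "(\<Sum>e\<in>attach P f. card e) = (\<Sum>p\<in>P. card (insert (f p) p))"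
    unfolding attach_def by (subst sum.reindex[OF inj]) simp
  also have "\<dots> = (\<Sum>p\<in>P. card p + 1)"
    using fp parent_not_in[OF f] by (intro sum.cong) auto
  also have "\<dots> = (\<Sum>p\<in>P. card p) + card P" by (simp only: sum.distrib) simp
  also have "(\<Sum>p\<in>P. card p) = card V - 1"
    using dj fp fV by (subst card_Union_disjoint[symmetric]) (auto simp: disjoint_def pairwise_def)
  finally have "int (\<Sum>e\<in>attach P f. card e) = int (card V) + int (card (attach P f)) - 1"
    using fV card_image[OF inj] card_gt_0_iff[of V] by (auto simp: attach_def of_nat_diff)
  moreover have "connected_hypergraph V (attach P f)"
    using dj fV by (intro attach_connected[OF f]) auto
  ultimately show ?thesis using fV by (simp add: finite_hypertree_def)
qed

text \<open>Going up from the root, the \<open>f\<close>-parent and the vertex closest to the root must agree: the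
  first disagreement would put a vertex in two reduced hyperedges.\<close>

lemma closest_attach:
  assumes f: "f \<in> parent_maps r P" and fV: "finite V" "r \<in> V" and P: "partition_on (V - {r}) P"
    and p: "p \<in> P"
  shows "closest V (attach P f) r (insert (f p) p) = f p"
proof -
  let ?E = "attach P f" and ?e = "\<lambda>p. insert (f p) p"
  have dj: "disjoint P" "{} \<notin> P" "\<Union>P = V - {r}" using P by (auto simp: partition_on_def)
  note inj = inj_on_attach_edge[OF f dj(1,2)]
  obtain g where g: "\<And>e. e \<in> ?E \<Longrightarrow> reduced V ?E r e = {v \<in> V - {r}. g v = e}"
    by (rule hypertree_reduced[OF attach_hypertree[OF f fV P] fV(2)]) (rule that)
  obtain h :: "'a \<Rightarrow> nat" where h: "\<And>p v. p \<in> P \<Longrightarrow> v \<in> p \<Longrightarrow> h (f p) < h v"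
    using f by (auto simp: parent_maps_def)
  have eE: "?e p \<in> ?E" if "p \<in> P" for p using that by (auto simp: attach_def)
  show ?thesis using p
  proof (induction "h (f p)" arbitrary: p rule: less_induct)
    case less
    show ?case
    proof (rule ccontr)
      assume "closest V ?E r (?e p) \<noteq> f p"
      then have 1: "f p \<in> reduced V ?E r (?e p)" by (simp add: reduced_def)
      then have "f p \<in> V - {r}" unfolding g(1)[OF eE[OF less.prems]] by blast
      then obtain q where q: "q \<in> P" "f p \<in> q" using dj(3) by blast
      have "closest V ?E r (?e q) = f q"
        by (rule less.hyps[OF h[OF q] q(1)])
      then have "f p \<in> reduced V ?E r (?e q)"
        using q parent_not_in[OF f q(1)] by (auto simp: reduced_def)
      with 1 have "?e p = ?e q"
        unfolding g(1)[OF eE[OF less.prems]] g(1)[OF eE[OF q(1)]] by simp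
      then have "p = q" by (rule inj_onD[OF inj _ less.prems q(1)])
      then show False using q parent_not_in[OF f q(1)] by blast
    qed
  qed
qed

text \<open>By \<open>closest_attach\<close> the hyperedges determine the map: reduction returns the
  part and the closest vertex its parent. Surjectivity is \<open>attach_parents\<close>.\<close>

lemma bij_attach:
  assumes fV: "finite V" "r \<in> V" and P: "partition_on (V - {r}) P"
  shows "bij_betw (attach P) (parent_maps r P) (rooted_hypertrees V r P)"
proof (rule bij_betw_imageI)
  have red: "reduced V (attach P f) r (insert (f p) p) = p"
    if "f \<in> parent_maps r P" "p \<in> P" for f p
    using closest_attach[OF that(1) fV P that(2)] parent_not_in[OF that] by (auto simp: reduced_def)
  show "inj_on (attach P) (parent_maps r P)"
  proof (rule inj_onI)
    fix f g assume f: "f \<in> parent_maps r P" and g: "g \<in> parent_maps r P"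
      and eq: "attach P f = attach P g"
    show "f = g"
    proof (rule PiE_ext[of f P "\<lambda>_. insert r (\<Union>P)" g])
      fix p assume p: "p \<in> P"
      have "insert (f p) p \<in> attach P g" using p eq by (auto simp: attach_def)
      then obtain q where q: "q \<in> P" "insert (f p) p = insert (g q) q" by (auto simp: attach_def)
      then have "p = q" using red[OF f p] red[OF g q(1)] eq by simp
      have "f p = closest V (attach P g) r (insert (g q) q)"
        using closest_attach[OF f fV P p] unfolding eq q(2) by (rule sym)
      also have "\<dots> = g q" by (rule closest_attach[OF g fV P q(1)])
      finally show "f p = g p" using \<open>p = q\<close> by simp
    qed (use f g in \<open>auto simp: parent_maps_def\<close>)
  qed
  have "attach P f \<in> rooted_hypertrees V r P" if f: "f \<in> parent_maps r P" for f
  proof -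
    have "reduced V (attach P f) r ` (\<lambda>p. insert (f p) p) ` P = (\<lambda>p. p) ` P"
      unfolding image_image by (rule image_cong[OF refl red[OF f]])
    then have "reduced V (attach P f) r ` attach P f = P"
      by (simp add: attach_def[symmetric])
    then show ?thesis using attach_hypertree[OF f fV P] fV
      by (simp add: rooted_hypertrees_def pruefer_partition_def)
  qed
  moreover have "E \<in> attach P ` parent_maps r P" if "E \<in> rooted_hypertrees V r P" for E
    using attach_parents[OF that] by (metis imageI)
  ultimately show "attach P ` parent_maps r P = rooted_hypertrees V r P" by blast
qed

text \<open>A non-root vertex lies in the hyperedge of its own part and in those of the parts
  attached to it. Together with \<open>count_code\<close> this yields degree minus one.\<close>

lemma hdegree_attach:
  assumes f: "f \<in> parent_maps r P" and P: "disjoint P" "{} \<notin> P" "finite P" and v: "v \<in> \<Union>P"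
  shows "hdegree (attach P f) v = card {p \<in> P. f p = v} + 1"
proof -
  obtain q where q: "q \<in> P" "v \<in> q" using v by blast
  have "{e \<in> attach P f. v \<in> e} = (\<lambda>p. insert (f p) p) ` {p \<in> P. v \<in> insert (f p) p}"
    by (auto simp: attach_def)
  then have "hdegree (attach P f) v = card {p \<in> P. v \<in> insert (f p) p}"
    unfolding hdegree_def using inj_on_attach_edge[OF f P(1,2)]
    by (simp add: card_image inj_on_subset)
  moreover have "{p \<in> P. v \<in> insert (f p) p} = insert q {p \<in> P. f p = v}"
    using q P(1) by (auto dest: disjointD)
  moreover have "q \<notin> {p \<in> P. f p = v}" using q parent_not_in[OF f q(1)] by auto
  ultimately show ?thesis using P(3) by simp
qed

section \<open>Programs and their running time\<close>

text \<open>An upper bound for the running time of a program all of whose loops make at most \<open>n\<close>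
  iterations, as a polynomial in \<open>n\<close>.\<close>

primrec cost_poly :: "com \<Rightarrow> nat poly" where
  "cost_poly Skip = [:1:]"
| "cost_poly (Assign x a b) = [:acost a + acost b + 1:]"
| "cost_poly (Seq c1 c2) = cost_poly c1 + cost_poly c2"
| "cost_poly (Cond b c1 c2) = [:bcost b + 1:] + cost_poly c1 + cost_poly c2"
| "cost_poly (While b c) = [:1, 1:] * ([:bcost b + 1:] + cost_poly c)"

text \<open>Total correctness with the time bound built in, so that one pass through a program
  proves termination, running time and result. The number \<open>n\<close> bounds the iterations of
  each loop.\<close>

definition run :: "nat \<Rightarrow> com \<Rightarrow> memory \<Rightarrow> (memory \<Rightarrow> bool) \<Rightarrow> bool" where
  "run n c s Q \<longleftrightarrow> (\<exists>t s'. exec c s t s' \<and> t \<le> poly (cost_poly c) n \<and> Q s')"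

section \<open>Proof rules for timed total correctness\<close>

lemma run_mono: "run n c s Q \<Longrightarrow> (\<And>s'. Q s' \<Longrightarrow> R s') \<Longrightarrow> run n c s R"
  by (auto simp: run_def)

lemma run_Skip: "Q s \<Longrightarrow> run n Skip s Q"
  unfolding run_def by (intro exI conjI, rule exec.Skip) auto

lemma run_Assign:
  "Q (s(x := (s x)(aval a s := aval b s))) \<Longrightarrow> run n (Assign x a b) s Q"
  unfolding run_def by (intro exI conjI, rule exec.Assign) auto

lemma run_Seq: "run n c1 s (\<lambda>s'. run n c2 s' Q) \<Longrightarrow> run n (Seq c1 c2) s Q"
  unfolding run_def by (fastforce intro: exec.Seq)

lemma run_Cond:
  assumes "bval b s \<Longrightarrow> run n c1 s Q" "\<not> bval b s \<Longrightarrow> run n c2 s Q"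
  shows "run n (Cond b c1 c2) s Q"
  using assms unfolding run_def
  by (cases "bval b s") (fastforce intro: exec.CondTrue exec.CondFalse)+

definition for_loop :: "string \<Rightarrow> aexp \<Rightarrow> com \<Rightarrow> com" where
  "for_loop x a c =
     Seq (Assign x (Const 0) (Const 0))
       (While (Less (Cell x (Const 0)) a)
         (Seq c (Assign x (Const 0) (Plus (Cell x (Const 0)) (Const 1)))))"

lemma run_while:
  assumes N: "N \<le> n"
    and body: "\<And>k s. k < N \<Longrightarrow> I k s \<Longrightarrow> run n c s (I (Suc k))"
    and guard: "\<And>k s. k \<le> N \<Longrightarrow> I k s \<Longrightarrow> bval b s \<longleftrightarrow> k < N"
    and "I 0 s"
  shows "run n (While b c) s (I N)"
proof -
  let ?B = "bcost b + 1 + poly (cost_poly c) n"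
  \<comment> \<open>Induction on the number \<open>j\<close> of iterations still to come; the
    additional \<open>?B\<close> pays for the final failing test.\<close>
  have "\<exists>t s'. exec (While b c) s t s' \<and> t \<le> (j + 1) * ?B \<and> I N s'"
    if "j \<le> N" "I (N - j) s" for j s
    using that
  proof (induction j arbitrary: s)
    case 0
    then have "exec (While b c) s (bcost b + 1) s" using guard[of N s] by (intro exec.WhileFalse) simp
    then show ?case using 0 by (intro exI conjI) auto
  next
    case (Suc j)
    then have b: "bval b s" using guard[of "N - Suc j" s] by simp
    have "run n c s (I (Suc (N - Suc j)))" using Suc.prems by (intro body) auto
    then obtain t s' where s': "exec c s t s'" "t \<le> poly (cost_poly c) n" "I (Suc (N - Suc j)) s'"
      by (auto simp: run_def)
    moreover have "Suc (N - Suc j) = N - j" using Suc.prems by simp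
    ultimately obtain t' s'' where s'': "exec (While b c) s' t' s''" "t' \<le> (j + 1) * ?B" "I N s''"
      using Suc.IH[of s'] Suc.prems by auto
    have "exec (While b c) s (bcost b + 1 + t + t') s''"
      by (rule exec.WhileTrue[OF b s'(1) s''(1)])
    moreover have "bcost b + 1 + t + t' \<le> (Suc j + 1) * ?B" using s'(2) s''(2) by simp
    ultimately show ?case using s''(3) by blast
  qed
  from this[of N s] obtain t s' where "exec (While b c) s t s'" "t \<le> (N + 1) * ?B" "I N s'"
    using assms by auto
  moreover have "(N + 1) * ?B \<le> (n + 1) * ?B" using N by (intro mult_right_mono) auto
  moreover have "(n + 1) * ?B = poly (cost_poly (While b c)) n" by (simp add: algebra_simps)
  ultimately show ?thesis unfolding run_def by (metis le_trans)
qed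

text \<open>\<open>I k\<close> is meant for the memory in which the counter has just been set to
  \<open>k\<close>, hence the update by \<open>Suc k\<close> in \<open>body\<close>. The limit
  \<open>a\<close> is evaluated again before each iteration, so \<open>bound\<close> must follow
  from the invariant.\<close>

lemma run_for:
  assumes N: "N \<le> n"
    and init: "I 0 (s(x := (s x)(0 := 0)))"
    and body: "\<And>k s. k < N \<Longrightarrow> I k s \<Longrightarrow> s x 0 = k \<Longrightarrow>
      run n c s (\<lambda>s'. s' x 0 = k \<and> I (Suc k) (s'(x := (s' x)(0 := Suc k))))"
    and bound: "\<And>k s. I k s \<Longrightarrow> aval a s = N"
    and post: "\<And>s. I N s \<Longrightarrow> Q s"
  shows "run n (for_loop x a c) s Q"
  unfolding for_loop_def
proof (intro run_Seq run_Assign)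
  let ?I = "\<lambda>k s. I k s \<and> s x 0 = k"
  have "run n (While (Less (Cell x (Const 0)) a)
      (Seq c (Assign x (Const 0) (Plus (Cell x (Const 0)) (Const 1)))))
      (s(x := (s x)(0 := 0))) (?I N)"
  proof (rule run_while[OF N])
    fix k s assume "k < N" "?I k s"
    then have "run n c s (\<lambda>s'. s' x 0 = k \<and> I (Suc k) (s'(x := (s' x)(0 := Suc k))))"
      using body by blast
    then show "run n (Seq c (Assign x (Const 0) (Plus (Cell x (Const 0)) (Const 1)))) s (?I (Suc k))"
      by (intro run_Seq) (auto intro!: run_Assign elim: run_mono)
  next
    show "?I 0 (s(x := (s x)(0 := 0)))" by (rule conjI[OF init]) simp
  qed (use bound in auto)
  then show "run n (While (Less (Cell x (Const 0)) a)
      (Seq c (Assign x (Const 0) (Plus (Cell x (Const 0)) (Const 1)))))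
      (s(x := (s x)(aval (Const 0) s := aval (Const 0) s))) Q"
    using post by (auto elim: run_mono)
qed

text \<open>A frame condition: \<open>X\<close> collects the arrays that a program may
  change.\<close>

definition agree :: "string set \<Rightarrow> memory \<Rightarrow> memory \<Rightarrow> bool" where
  "agree X s s' \<longleftrightarrow> (\<forall>x. x \<notin> X \<longrightarrow> s' x = s x)"

lemma agree_refl [simp]: "agree X s s"
  by (simp add: agree_def)

lemma agree_update [simp]: "x \<in> X \<Longrightarrow> agree X s (s'(x := v)) \<longleftrightarrow> agree X s s'"
  by (auto simp: agree_def)

lemma agree_trans: "agree X s s' \<Longrightarrow> agree Y s' s'' \<Longrightarrow> X \<subseteq> Z \<Longrightarrow> Y \<subseteq> Z \<Longrightarrow> agree Z s s''"
  unfolding agree_def by (metis subsetD)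

section \<open>The program computing the code\<close>

abbreviation var :: "string \<Rightarrow> aexp" where
  "var x \<equiv> Cell x (Const 0)"

abbreviation set_var :: "string \<Rightarrow> aexp \<Rightarrow> com" where
  "set_var x a \<equiv> Assign x (Const 0) a"

abbreviation vertex_count :: aexp where "vertex_count \<equiv> Cell ''input'' (Const 1)"
abbreviation root_vertex :: aexp where "root_vertex \<equiv> Cell ''input'' (Const 2)"
abbreviation edge_count :: aexp where "edge_count \<equiv> Cell ''input'' (Const 3)"

text \<open>The variable \<open>q\<close> points to the row of the incidence matrix that belongs to the hyperedge
  \<open>j\<close>.\<close>

definition add_row :: com where
  "add_row = for_loop ''i'' vertex_count
     (Assign ''D'' (var ''i'')
       (Plus (Cell ''D'' (var ''i'')) (Cell ''input'' (Plus (var ''q'') (var ''i'')))))"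

text \<open>The initial 1 stands for a virtual part containing the root. Then every remaining
  vertex, root or not, has degree one exactly when no remaining part is attached to it.\<close>

definition degrees :: com where
  "degrees =
     Seq (for_loop ''i'' vertex_count (Assign ''D'' (var ''i'') (Const 0)))
     (Seq (Assign ''D'' root_vertex (Const 1))
     (Seq (set_var ''q'' (Const 4))
       (for_loop ''j'' edge_count (Seq add_row (set_var ''q'' (Plus (var ''q'') vertex_count))))))"

text \<open>At the end \<open>a\<close> is the successor of the largest degree-one vertex of the row
  (0 if there is none), \<open>c\<close> counts the other vertices of the row, and \<open>p\<close>
  is the last of these.\<close>

definition scan_row :: com where
  "scan_row = Seq (set_var ''a'' (Const 0)) (Seq (set_var ''c'' (Const 0))
     (for_loop ''i'' vertex_count
       (Cond (Equal (Cell ''input'' (Plus (var ''q'') (var ''i''))) (Const 1))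
         (Cond (Equal (Cell ''D'' (var ''i'')) (Const 1))
           (set_var ''a'' (Plus (var ''i'') (Const 1)))
           (Seq (set_var ''c'' (Plus (var ''c'') (Const 1))) (set_var ''p'' (var ''i''))))
         Skip)))"

text \<open>A hyperedge is a leaf if only one of its vertices has degree other than one; \<open>b\<close> holds the
  successor of the largest vertex of degree one seen in a leaf.\<close>

definition select :: com where
  "select =
     Seq (set_var ''b'' (Const 0))
     (Seq (set_var ''q'' (Const 4))
       (for_loop ''j'' edge_count
         (Seq scan_row
         (Seq (Cond (Conj (Equal (var ''c'') (Const 1)) (Less (var ''b'') (var ''a'')))
            (Seq (set_var ''b'' (var ''a''))
            (Seq (set_var ''s'' (var ''q'')) (set_var ''w'' (var ''p''))))
            Skip)
         (set_var ''q'' (Plus (var ''q'') vertex_count))))))"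

text \<open>A removed hyperedge remains as a zero row, which keeps the row addresses fixed;
  \<open>select\<close> ignores it because its count \<open>c\<close> is 0. The output index is
  shifted since cell 0 holds the length.\<close>

definition remove_edge :: com where
  "remove_edge =
     Seq (for_loop ''i'' vertex_count (Assign ''input'' (Plus (var ''s'') (var ''i'')) (Const 0)))
       (Assign ''output'' (Plus (var ''t'') (Const 1)) (var ''w''))"

definition pruefer :: com where
  "pruefer =
     Seq (Assign ''output'' (Const 0) (Minus edge_count (Const 1)))
       (for_loop ''t'' (Minus edge_count (Const 1)) (Seq degrees (Seq select remove_edge)))"

section \<open>Specifications of the subprograms\<close>

lemma run_add_row:
  assumes "s ''input'' 1 = n"
  shows "run n add_row s (\<lambda>s'. agree {''i'', ''D''} s s' \<and>
    (\<forall>x<n. s' ''D'' x = s ''D'' x + s ''input'' (s ''q'' 0 + x)))"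
proof -
  let ?I = "\<lambda>k s'. agree {''i'', ''D''} s s' \<and>
    (\<forall>x. s' ''D'' x = s ''D'' x + (if x < k then s ''input'' (s ''q'' 0 + x) else 0))"
  show ?thesis unfolding add_row_def
  proof (rule run_for[where N = n and I = ?I])
    fix k s' assume k: "k < n" "?I k s'" "s' ''i'' 0 = k"
    then have "s' ''input'' = s ''input''" "s' ''q'' = s ''q''" by (simp_all add: agree_def)
    with k show "run n (Assign ''D'' (var ''i'')
       (Plus (Cell ''D'' (var ''i'')) (Cell ''input'' (Plus (var ''q'') (var ''i''))))) s'
       (\<lambda>s'. s' ''i'' 0 = k \<and> ?I (Suc k) (s'(''i'' := (s' ''i'')(0 := Suc k))))"
      by (intro run_Assign) auto
  next
    fix k s' assume "?I k s'"
    then show "aval vertex_count s' = n" using assms by (simp_all add: agree_def)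
  qed auto
qed

lemma run_degrees:
  assumes n: "s ''input'' 1 = n" and m: "s ''input'' 3 = m" "m \<le> n"
  shows "run n degrees s (\<lambda>s'. agree {''i'', ''j'', ''q'', ''D''} s s' \<and>
    (\<forall>x<n. s' ''D'' x = of_bool (x = s ''input'' 2) + (\<Sum>j<m. s ''input'' (4 + j * n + x))))"
proof -
  let ?X = "{''i'', ''j'', ''q'', ''D''}"
  let ?I = "\<lambda>k s'. agree {''i'', ''D''} s s' \<and> (\<forall>x<k. s' ''D'' x = 0)"
  let ?J = "\<lambda>k s'. agree ?X s s' \<and> s' ''q'' 0 = 4 + k * n \<and> (\<forall>x<n. s' ''D'' x =
      of_bool (x = s ''input'' 2) + (\<Sum>j<k. s ''input'' (4 + j * n + x)))"
  have "run n (for_loop ''i'' vertex_count (Assign ''D'' (var ''i'') (Const 0))) s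
    (\<lambda>s'. run n (Assign ''D'' root_vertex (Const 1)) s' (\<lambda>s'. run n (set_var ''q'' (Const 4)) s'
      (\<lambda>s'. run n (for_loop ''j'' edge_count (Seq add_row (set_var ''q'' (Plus (var ''q'') vertex_count))))
         s' (?J m))))"
  proof (rule run_for[where N = n and I = ?I])
    fix k s' assume k: "k < n" "?I k s'" "s' ''i'' 0 = k"
    then show "run n (Assign ''D'' (var ''i'') (Const 0)) s'
       (\<lambda>s'. s' ''i'' 0 = k \<and> ?I (Suc k) (s'(''i'' := (s' ''i'')(0 := Suc k))))"
      by (intro run_Assign) (auto simp: less_Suc_eq)
  next
    fix k s' assume "?I k s'"
    then show "aval vertex_count s' = n" using n by (simp_all add: agree_def)
  next
    fix s1 assume s1: "?I n s1"
    then have i1: "s1 ''input'' = s ''input''" by (simp_all add: agree_def)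
    have a1: "agree ?X s s1" using s1 by (auto simp: agree_def)
    show "run n (Assign ''D'' root_vertex (Const 1)) s1 (\<lambda>s'. run n (set_var ''q'' (Const 4)) s'
      (\<lambda>s'. run n (for_loop ''j'' edge_count (Seq add_row (set_var ''q'' (Plus (var ''q'') vertex_count))))
         s' (?J m)))"
    proof (intro run_Assign, rule run_for[where N = m and I = ?J])
      fix k s' assume k: "k < m" "?J k s'" "s' ''j'' 0 = k"
      then have i: "s' ''input'' = s ''input''" by (simp_all add: agree_def)
      have "run n add_row s' (\<lambda>s''. agree {''i'', ''D''} s' s'' \<and>
          (\<forall>x<n. s'' ''D'' x = s' ''D'' x + s' ''input'' (s' ''q'' 0 + x)))"
        using i n by (intro run_add_row) simp
      then show "run n (Seq add_row (set_var ''q'' (Plus (var ''q'') vertex_count))) s'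
         (\<lambda>s'. s' ''j'' 0 = k \<and> ?J (Suc k) (s'(''j'' := (s' ''j'')(0 := Suc k))))"
      proof (intro run_Seq, elim run_mono, intro run_Assign)
        fix s'' assume s'': "agree {''i'', ''D''} s' s'' \<and>
          (\<forall>x<n. s'' ''D'' x = s' ''D'' x + s' ''input'' (s' ''q'' 0 + x))"
        then have e: "s'' ''input'' = s ''input''" "s'' ''q'' = s' ''q''" "s'' ''j'' = s' ''j''"
          using i by (simp_all add: agree_def)
        have "agree ?X s s''"
          by (rule agree_trans[of ?X s s' "{''i'', ''D''}"]) (use k s'' in auto)
        then show "(\<lambda>s'. s' ''j'' 0 = k \<and> ?J (Suc k) (s'(''j'' := (s' ''j'')(0 := Suc k))))
          (s''(''q'' := (s'' ''q'')
            (aval (Const 0) s'' := aval (Plus (var ''q'') vertex_count) s'')))"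
          using k s'' e i n by (simp add: add_ac)
      qed
    next
      fix k s' assume "?J k s'"
      then show "aval edge_count s' = m" using m by (simp_all add: agree_def)
    qed (use m s1 a1 i1 in auto)
  qed auto
  then have "run n degrees s (?J m)" unfolding degrees_def
    by - (rule run_Seq, erule run_mono, rule run_Seq, erule run_mono, rule run_Seq, erule run_mono)
  then show ?thesis by (rule run_mono) blast
qed

text \<open>In an upward scan the latest hit is the maximum; this is the step that
  \<open>scan_row\<close> performs on \<open>a\<close>.\<close>

lemma Max_insert_0_Suc_less:
  "Max (insert 0 (Suc ` {i. i < Suc k \<and> P i})) =
    (if P k then Suc k else Max (insert 0 (Suc ` {i. i < k \<and> P i})))"
proof -
  let ?S = "\<lambda>k. insert 0 (Suc ` {i. i < k \<and> P i})"
  have fin: "finite (?S k)" for k by simp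
  show ?thesis
  proof (cases "P k")
    case True
    have "Max (?S (Suc k)) = Suc k" by (rule Max_eqI) (use True in auto)
    then show ?thesis using True by simp
  next
    case False
    then have "{i. i < Suc k \<and> P i} = {i. i < k \<and> P i}" by (auto simp: less_Suc_eq)
    then show ?thesis using False by simp
  qed
qed

text \<open>\<open>M\<close> is a row and \<open>d\<close> the table of degrees. The shift by
  \<open>Suc\<close> reserves 0 for rows without a degree-one vertex, so the initial
  \<open>b = 0\<close> loses against every other row.\<close>

definition top_leg :: "(nat \<Rightarrow> nat) \<Rightarrow> (nat \<Rightarrow> nat) \<Rightarrow> nat \<Rightarrow> nat" where
  "top_leg M d n = Max (insert 0 (Suc ` {i. i < n \<and> M i = 1 \<and> d i = 1}))"

definition branches :: "(nat \<Rightarrow> nat) \<Rightarrow> (nat \<Rightarrow> nat) \<Rightarrow> nat \<Rightarrow> nat set" where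
  "branches M d n = {i. i < n \<and> M i = 1 \<and> d i \<noteq> 1}"

lemma run_scan_row:
  assumes n: "s ''input'' 1 = n" and M: "\<And>i. M i = s ''input'' (s ''q'' 0 + i)"
  shows "run n scan_row s (\<lambda>s'. agree {''i'', ''a'', ''c'', ''p''} s s' \<and>
    s' ''a'' 0 = top_leg M (s ''D'') n \<and> s' ''c'' 0 = card (branches M (s ''D'') n) \<and>
    (0 < s' ''c'' 0 \<longrightarrow> s' ''p'' 0 \<in> branches M (s ''D'') n))"
proof -
  let ?d = "s ''D''"
  let ?I = "\<lambda>k s'. agree {''i'', ''a'', ''c'', ''p''} s s' \<and>
    s' ''a'' 0 = top_leg M ?d k \<and> s' ''c'' 0 = card (branches M ?d k) \<and>
    (0 < s' ''c'' 0 \<longrightarrow> s' ''p'' 0 \<in> branches M ?d k)"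
  have b: "branches M ?d (Suc k) =
      (if M k = 1 \<and> ?d k \<noteq> 1 then insert k (branches M ?d k) else branches M ?d k)" for k
    by (auto simp: branches_def less_Suc_eq)
  have f: "finite (branches M ?d k)" "k \<notin> branches M ?d k" for k
    by (auto simp: branches_def)
  have t: "top_leg M ?d (Suc k) = (if M k = 1 \<and> ?d k = 1 then Suc k else top_leg M ?d k)" for k
    unfolding top_leg_def by (rule Max_insert_0_Suc_less)
  show ?thesis unfolding scan_row_def
  proof (intro run_Seq run_Assign, rule run_for[where N = n and I = ?I])
    fix k s' assume k: "k < n" "?I k s'" "s' ''i'' 0 = k"
    then have e: "s' ''input'' = s ''input''" "s' ''q'' = s ''q''" "s' ''D'' = ?d"
      by (simp_all add: agree_def)
    show "run n (Cond (Equal (Cell ''input'' (Plus (var ''q'') (var ''i''))) (Const 1))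
         (Cond (Equal (Cell ''D'' (var ''i'')) (Const 1))
           (set_var ''a'' (Plus (var ''i'') (Const 1)))
           (Seq (set_var ''c'' (Plus (var ''c'') (Const 1))) (set_var ''p'' (var ''i''))))
         Skip) s'
       (\<lambda>s'. s' ''i'' 0 = k \<and> ?I (Suc k) (s'(''i'' := (s' ''i'')(0 := Suc k))))"
      using k f[of k] by (intro run_Cond run_Seq run_Assign run_Skip) (simp_all add: e b t M)
  next
    fix k s' assume "?I k s'"
    then show "aval vertex_count s' = n" using n by (simp add: agree_def)
  qed (auto simp: top_leg_def branches_def)
qed

text \<open>\<open>J\<close> is the row that has to win. Rows with a number of branches other than
  one are skipped, so \<open>top\<close> restricts only those with a single branch.\<close>

lemma run_select:
  assumes n: "s ''input'' 1 = n" and m: "s ''input'' 3 = m" "m \<le> n"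
    and M: "\<And>j i. M j i = s ''input'' (4 + j * n + i)"
    and J: "J < m" "branches (M J) (s ''D'') n = {v}" "0 < top_leg (M J) (s ''D'') n"
    and top: "\<And>j. j < m \<Longrightarrow> j \<noteq> J \<Longrightarrow> card (branches (M j) (s ''D'') n) = 1 \<Longrightarrow>
      top_leg (M j) (s ''D'') n < top_leg (M J) (s ''D'') n"
  shows "run n select s (\<lambda>s'.
    agree {''i'', ''j'', ''q'', ''a'', ''c'', ''p'', ''b'', ''s'', ''w''} s s' \<and>
    s' ''s'' 0 = 4 + J * n \<and> s' ''w'' 0 = v)"
proof -
  let ?X = "{''i'', ''j'', ''q'', ''a'', ''c'', ''p'', ''b'', ''s'', ''w''}"
  let ?d = "s ''D''"
  let ?T = "top_leg (M J) ?d n"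
  \<comment> \<open>Up to row \<open>J\<close> only a strict bound on \<open>b\<close> is
    maintained, enough for \<open>J\<close> to be accepted; afterwards nothing can displace
    it.\<close>
  let ?I = "\<lambda>k s'. agree ?X s s' \<and> s' ''q'' 0 = 4 + k * n \<and>
    (if J < k then s' ''b'' 0 = ?T \<and> s' ''s'' 0 = 4 + J * n \<and> s' ''w'' 0 = v
     else s' ''b'' 0 < ?T)"
  have "run n select s (?I m)" unfolding select_def
  proof (intro run_Seq run_Assign, rule run_for[where N = m and I = ?I])
    fix k s' assume k: "k < m" "?I k s'" "s' ''j'' 0 = k"
    then have e: "s' ''input'' = s ''input''" "s' ''D'' = ?d" by (simp_all add: agree_def)
    have scan: "run n scan_row s' (\<lambda>s''. agree {''i'', ''a'', ''c'', ''p''} s' s'' \<and>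
        s'' ''a'' 0 = top_leg (M k) (s' ''D'') n \<and>
        s'' ''c'' 0 = card (branches (M k) (s' ''D'') n) \<and>
        (0 < s'' ''c'' 0 \<longrightarrow> s'' ''p'' 0 \<in> branches (M k) (s' ''D'') n))"
      using e n k by (intro run_scan_row) (simp_all add: M)
    show "run n (Seq scan_row
         (Seq (Cond (Conj (Equal (var ''c'') (Const 1)) (Less (var ''b'') (var ''a'')))
            (Seq (set_var ''b'' (var ''a''))
            (Seq (set_var ''s'' (var ''q'')) (set_var ''w'' (var ''p''))))
            Skip)
         (set_var ''q'' (Plus (var ''q'') vertex_count)))) s'
       (\<lambda>s'. s' ''j'' 0 = k \<and> ?I (Suc k) (s'(''j'' := (s' ''j'')(0 := Suc k))))"
    proof (rule run_Seq, rule run_mono[OF scan], rule run_Seq)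
      fix s'' assume s'': "agree {''i'', ''a'', ''c'', ''p''} s' s'' \<and>
        s'' ''a'' 0 = top_leg (M k) (s' ''D'') n \<and>
        s'' ''c'' 0 = card (branches (M k) (s' ''D'') n) \<and>
        (0 < s'' ''c'' 0 \<longrightarrow> s'' ''p'' 0 \<in> branches (M k) (s' ''D'') n)"
      then have e': "s'' ''input'' = s ''input''" "s'' ''q'' = s' ''q''" "s'' ''j'' = s' ''j''"
        "s'' ''b'' = s' ''b''" "s'' ''s'' = s' ''s''" "s'' ''w'' = s' ''w''"
        using e by (simp_all add: agree_def)
      have a: "agree ?X s s''"
        by (rule agree_trans[of ?X s s' "{''i'', ''a'', ''c'', ''p''}"]) (use k s'' in auto)
      have at_J: "s'' ''c'' 0 = 1 \<and> s'' ''a'' 0 = ?T \<and> s'' ''p'' 0 = v" if "k = J"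
        using s'' e that J(2) by simp
      have off_J: "s'' ''c'' 0 \<noteq> 1 \<or> s'' ''a'' 0 < ?T" if "k \<noteq> J"
        using s'' e that top[OF k(1)] by auto
      consider "k < J" | "k = J" | "J < k" by linarith
      then show "run n (Cond (Conj (Equal (var ''c'') (Const 1)) (Less (var ''b'') (var ''a'')))
            (Seq (set_var ''b'' (var ''a''))
            (Seq (set_var ''s'' (var ''q'')) (set_var ''w'' (var ''p''))))
            Skip) s'' (\<lambda>s'. run n (set_var ''q'' (Plus (var ''q'') vertex_count)) s'
              (\<lambda>s'. s' ''j'' 0 = k \<and> ?I (Suc k) (s'(''j'' := (s' ''j'')(0 := Suc k)))))"
      proof cases
        case 1
        then show ?thesis using k a off_J n
          by (intro run_Cond run_Seq run_Assign run_Skip) (auto simp: e')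
      next
        case 2
        then show ?thesis using k a at_J n
          by (intro run_Cond run_Seq run_Assign run_Skip) (auto simp: e')
      next
        case 3
        then show ?thesis using k a off_J n
          by (intro run_Cond run_Seq run_Assign run_Skip) (auto simp: e')
      qed
    qed
  next
    fix k s' assume "?I k s'"
    then show "aval edge_count s' = m" using m by (simp add: agree_def)
  qed (use m J in auto)
  then show ?thesis by (rule run_mono) (use J in simp)
qed

text \<open>The bound on the row address protects the header, so the loop limit in cell 1 survives
  the deletion.\<close>

lemma run_remove_edge:
  assumes n: "s ''input'' 1 = n" and o: "4 \<le> s ''s'' 0"
  shows "run n remove_edge s (\<lambda>s'. agree {''i'', ''input'', ''output''} s s' \<and>
    s' ''input'' = (\<lambda>x. if s ''s'' 0 \<le> x \<and> x < s ''s'' 0 + n then 0 else s ''input'' x) \<and>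
    s' ''output'' = (s ''output'')(s ''t'' 0 + 1 := s ''w'' 0))"
proof -
  let ?I = "\<lambda>k s'. agree {''i'', ''input''} s s' \<and>
    s' ''input'' = (\<lambda>x. if s ''s'' 0 \<le> x \<and> x < s ''s'' 0 + k then 0 else s ''input'' x)"
  show ?thesis unfolding remove_edge_def
  proof (rule run_Seq, rule run_for[where N = n and I = ?I])
    fix k s' assume k: "k < n" "?I k s'" "s' ''i'' 0 = k"
    then have e: "s' ''s'' = s ''s''" by (simp add: agree_def)
    show "run n (Assign ''input'' (Plus (var ''s'') (var ''i'')) (Const 0)) s'
       (\<lambda>s'. s' ''i'' 0 = k \<and> ?I (Suc k) (s'(''i'' := (s' ''i'')(0 := Suc k))))"
      using k by (intro run_Assign) (auto simp: e fun_eq_iff)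
  next
    fix s' assume I: "?I n s'"
    have "s' ''output'' = s ''output''" "s' ''t'' = s ''t''" "s' ''w'' = s ''w''"
      using I[THEN conjunct1] by (simp_all add: agree_def)
    moreover have "agree {''i'', ''input'', ''output''} s s'"
      using I[THEN conjunct1] by (simp add: agree_def)
    ultimately show "run n (Assign ''output'' (Plus (var ''t'') (Const 1)) (var ''w'')) s'
      (\<lambda>s'. agree {''i'', ''input'', ''output''} s s' \<and>
    s' ''input'' = (\<lambda>x. if s ''s'' 0 \<le> x \<and> x < s ''s'' 0 + n then 0 else s ''input'' x) \<and>
    s' ''output'' = (s ''output'')(s ''t'' 0 + 1 := s ''w'' 0))"
      using I[THEN conjunct2] by (intro run_Assign) simp
  next
    fix k s' assume "?I k s'"
    then show "aval vertex_count s' = n" using n o by simp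
  qed (auto simp: fun_eq_iff)
qed

section \<open>Correctness of the program\<close>

text \<open>The summand for the root replaces the part of its own that every other vertex
  has.\<close>

lemma card_incident:
  assumes "finite A" "disjoint A" "r \<notin> \<Union>A" "\<forall>q\<in>A. f q \<notin> q" "v \<in> insert r (\<Union>A)"
  shows "of_bool (v = r) + card {q \<in> A. v \<in> insert (f q) q} = Suc (card {q \<in> A. f q = v})"
proof (cases "v = r")
  case True
  then have "{q \<in> A. v \<in> insert (f q) q} = {q \<in> A. f q = v}" using assms(3) by auto
  then show ?thesis using True by simp
next
  case False
  then obtain p where p: "p \<in> A" "v \<in> p" using assms(5) by auto
  then have "{q \<in> A. v \<in> insert (f q) q} = insert p {q \<in> A. f q = v}"
    using assms(2) by (auto dest: disjointD)
  moreover have "p \<notin> {q \<in> A. f q = v}" using p assms(4) by auto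
  ultimately show ?thesis using False assms(1) by simp
qed

lemma length_concat_rows:
  "(\<And>e. e \<in> set es \<Longrightarrow> length (h e) = n) \<Longrightarrow> length (concat (map h es)) = length es * n"
  by (induction es) auto

lemma nth_concat_rows:
  assumes "\<And>e. e \<in> set es \<Longrightarrow> length (h e) = n" "j < length es" "i < n"
  shows "concat (map h es) ! (j * n + i) = h (es ! j) ! i"
  using assms
proof (induction es arbitrary: j)
  case (Cons e es)
  show ?case
  proof (cases j)
    case 0
    then show ?thesis using Cons.prems(1)[of e] Cons.prems(3) by (simp add: nth_append)
  next
    case (Suc j')
    then show ?thesis using Cons.IH[of j'] Cons.prems by (simp add: nth_append add.assoc)
  qed
qed simp

text \<open>\<open>ps\<close> lists the parts in the order in which the input lists their
  hyperedges. It is arbitrary, since the output may not depend on that order.\<close>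

locale numbered_tree =
  fixes V :: "'a set" and r :: 'a and P :: "'a set set" and l :: "'a \<Rightarrow> nat"
    and f :: "'a set \<Rightarrow> 'a" and ps :: "'a set list"
  assumes finV: "finite V" and rV: "r \<in> V" and P: "partition_on (V - {r}) P"
    and l: "bij_betw l V {..<card V}"
    and f: "f \<in> parent_maps r P"
    and ps: "distinct ps" "set ps = P"
begin

abbreviation n :: nat where "n \<equiv> card V"
abbreviation m :: nat where "m \<equiv> length ps"

abbreviation edge :: "'a set \<Rightarrow> 'a set" where "edge p \<equiv> insert (f p) p"

definition key :: "'a set \<Rightarrow> nat" where "key p = Max (l ` p)"

text \<open>What is known of the family of parts still present. The restriction is needed because
  \<open>f\<close> is extensional on \<open>P\<close> only.\<close>

definition alive :: "'a set set \<Rightarrow> bool" where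
  "alive A \<longleftrightarrow> A \<subseteq> P \<and> A \<noteq> {} \<and> restrict f A \<in> parent_maps r A"

definition stores :: "'a set set \<Rightarrow> memory \<Rightarrow> bool" where
  "stores A s \<longleftrightarrow> s ''input'' 1 = n \<and> s ''input'' 2 = l r \<and> s ''input'' 3 = m \<and>
     (\<forall>j<m. \<forall>i<n. s ''input'' (4 + j * n + i) = of_bool (ps ! j \<in> A \<and> i \<in> l ` edge (ps ! j)))"

section \<open>Numbered trees and the parts still present\<close>

lemma parts: "disjoint P" "{} \<notin> P" "\<Union>P = V - {r}"
  using P by (auto simp: partition_on_def)

lemma finite_parts: "finite P"
  using ps(2) by (metis List.finite_set)

lemma finite_part: "p \<in> P \<Longrightarrow> finite p"
  using parts(3) finV by (metis Sup_upper finite_Diff finite_subset)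

lemma inj_l: "inj_on l V"
  using l by (simp add: bij_betw_def)

lemma l_less: "v \<in> V \<Longrightarrow> l v < n"
  using l by (auto simp: bij_betw_def)

lemma key_in: "p \<in> P \<Longrightarrow> key p \<in> l ` p"
  unfolding key_def using finite_part[of p] parts(2) by (intro Max_in) auto

lemma inj_key: "inj_on key P"
proof (rule inj_onI, rule ccontr)
  fix p q assume pq: "p \<in> P" "q \<in> P" "key p = key q" "p \<noteq> q"
  obtain u v where uv: "u \<in> p" "v \<in> q" "l u = l v" using key_in pq(1-3) by (metis imageE)
  moreover have "u \<in> V" "v \<in> V" using uv pq parts(3) by auto
  ultimately have "u = v" using inj_l by (meson inj_onD)
  then show False using uv pq parts(1) by (auto dest: disjointD)
qed

text \<open>The parts are nonempty and disjoint. This brings the loops over hyperedges and over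
  rounds under the common iteration bound \<open>n\<close>.\<close>

lemma length_le: "m \<le> n"
proof -
  have "card P \<le> (\<Sum>p\<in>P. card p)"
    using sum_mono[of P "\<lambda>_. 1" card] finite_part parts(2)
    by (simp add: Suc_le_eq card_gt_0_iff) metis
  also have "\<dots> = card (\<Union>P)"
    using parts(1) finite_part by (intro card_Union_disjoint[symmetric]) (auto simp: disjoint_def pairwise_def)
  also have "\<dots> \<le> n" unfolding parts(3) using finV by (intro card_mono) auto
  finally show ?thesis using ps distinct_card by fastforce
qed

lemma aliveD:
  assumes "alive A"
  shows "A \<subseteq> P" "finite A" "disjoint A" "r \<notin> \<Union>A" "\<forall>q\<in>A. f q \<notin> q" "\<forall>q\<in>A. f q \<in> insert r (\<Union>A)"
    "inj_on key A"
proof -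
  show A: "A \<subseteq> P" using assms by (simp add: alive_def)
  show "finite A" using A finite_parts by (rule finite_subset)
  show "disjoint A" using A parts(1) by (auto simp: pairwise_def)
  show "r \<notin> \<Union>A" using A parts(3) by auto
  show "\<forall>q\<in>A. f q \<notin> q" using A parent_not_in[OF f] by auto
  show "\<forall>q\<in>A. f q \<in> insert r (\<Union>A)"
    using assms parent_in[of "restrict f A" r A] by (auto simp: alive_def)
  show "inj_on key A" using inj_key A by (rule inj_on_subset)
qed

lemma top_leaf:
  assumes "alive A"
  shows "top_part key (leaves f A) \<in> leaves f A"
    and "q \<in> leaves f A \<Longrightarrow> q \<noteq> top_part key (leaves f A) \<Longrightarrow>
      key q < key (top_part key (leaves f A))"
proof -
  note A = aliveD[OF assms]
  have L: "finite (leaves f A)" "inj_on key (leaves f A)"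
    using A by (auto simp: leaves_def intro: inj_on_subset)
  have "leaves f A = leaves (restrict f A) A" by (rule leaves_cong) simp
  then have "leaves f A \<noteq> {}" using leaves_nonempty[of "restrict f A" r A] assms A(2)
    by (simp add: alive_def)
  then show t: "top_part key (leaves f A) \<in> leaves f A" using L by (intro top_part_in)
  show "key q < key (top_part key (leaves f A))"
    if "q \<in> leaves f A" "q \<noteq> top_part key (leaves f A)"
    using top_part_max[OF L(2,1) that(1)] t that L(2) by (metis inj_onD le_neq_implies_less)
qed

lemma alive_remove:
  assumes "alive A" "A - {top_part key (leaves f A)} \<noteq> {}"
  shows "alive (A - {top_part key (leaves f A)})"
proof -
  let ?p = "top_part key (leaves f A)"
  have "leaves f A = leaves (restrict f A) A" by (rule leaves_cong) simp
  then have "restrict (restrict f A) (A - {?p}) \<in> parent_maps r (A - {?p})"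
    using assms top_leaf(1)[OF assms(1)] by (intro restrict_parent_maps) (auto simp: alive_def)
  moreover have "A \<inter> (A - {?p}) = A - {?p}" by auto
  ultimately show ?thesis using assms by (auto simp: alive_def)
qed

lemma sum_incidence:
  assumes A: "alive A" and s: "stores A s" and v: "v \<in> V"
  shows "(\<Sum>j<m. s ''input'' (4 + j * n + l v)) = card {q \<in> A. v \<in> edge q}"
proof -
  have "l v \<in> l ` edge q \<longleftrightarrow> v \<in> edge q" if "q \<in> P" for q
  proof -
    have "edge q \<subseteq> V" using that parts(3) parent_in[OF f that] rV by auto
    then show ?thesis using inj_l v by (simp only: inj_on_image_mem_iff)
  qed
  then have "(\<Sum>j<m. s ''input'' (4 + j * n + l v)) =
      (\<Sum>j<m. of_bool (ps ! j \<in> A \<and> v \<in> edge (ps ! j)))"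
    using s l_less[OF v] aliveD(1)[OF A] by (intro sum.cong) (auto simp: stores_def)
  also have "\<dots> = (\<Sum>q\<in>P. of_bool (q \<in> A \<and> v \<in> edge q))"
    using bij_betw_nth[OF ps(1) refl ps(2)[symmetric]]
    by (rule sum.reindex_bij_betw)
  also have "\<dots> = card (P \<inter> {q. q \<in> A \<and> v \<in> edge q})"
    using finite_parts by (simp add: sum_of_bool_eq)
  also have "P \<inter> {q. q \<in> A \<and> v \<in> edge q} = {q \<in> A. v \<in> edge q}" using aliveD(1)[OF A] by auto
  finally show ?thesis .
qed

text \<open>Degree one means not being a parent. Hence the branches of a row are the parents in its
  hyperedge, and for a leaf the degree-one vertices form the part itself, so that
  \<open>top_leg\<close> compares keys.\<close>

lemma run_round:
  assumes A: "alive A" and s: "stores A s" and p: "p = top_part key (leaves f A)"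
  shows "run n (Seq degrees (Seq select remove_edge)) s (\<lambda>s'. stores (A - {p}) s' \<and>
    s' ''t'' = s ''t'' \<and> s' ''output'' = (s ''output'')(s ''t'' 0 + 1 := l (f p)))"
proof -
  note AD = aliveD[OF A]
  have pL: "p \<in> leaves f A" using top_leaf(1)[OF A] p by simp
  then have pA: "p \<in> A" by (simp add: leaves_def)
  have VA: "insert r (\<Union>A) \<subseteq> V" using AD(1) parts(3) rV by auto
  obtain J where J: "J < m" "ps ! J = p" using pA AD(1) ps(2) by (metis in_set_conv_nth subsetD)
  have n: "s ''input'' 1 = n" and m: "s ''input'' 3 = m" and r: "s ''input'' 2 = l r"
    using s by (auto simp: stores_def)
  define M where "M j i = s ''input'' (4 + j * n + i)" for j i
  have M: "M j i = of_bool (ps ! j \<in> A \<and> i \<in> l ` edge (ps ! j))" if "j < m" "i < n" for j i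
    using s that by (simp add: stores_def M_def)
  have M_1: "i \<in> l ` edge (ps ! j)" "ps ! j \<in> A" if "j < m" "i < n" "M j i = 1" for j i
    using M[OF that(1,2)] that(3) unfolding of_bool_def by presburger+
  show ?thesis
  proof (rule run_Seq, rule run_mono[OF run_degrees[of s n m, OF n m length_le]], elim conjE)
    fix s1 assume a1: "agree {''i'', ''j'', ''q'', ''D''} s s1"
      and D1: "\<forall>x<n. s1 ''D'' x = of_bool (x = s ''input'' 2) +
        (\<Sum>j<m. s ''input'' (4 + j * n + x))"
    have i1: "s1 ''input'' = s ''input''" "s1 ''output'' = s ''output''" "s1 ''t'' = s ''t''"
      using a1 by (simp_all add: agree_def)
    have D: "s1 ''D'' (l v) = Suc (card {q \<in> A. f q = v})" if v: "v \<in> insert r (\<Union>A)" for v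
    proof -
      have vV: "v \<in> V" using v VA by auto
      have "s1 ''D'' (l v) = of_bool (l v = l r) + card {q \<in> A. v \<in> edge q}"
        using D1 l_less[OF vV] sum_incidence[OF A s vV] r by simp
      also have "l v = l r \<longleftrightarrow> v = r" using inj_l vV rV by (meson inj_onD)
      finally show ?thesis using card_incident[OF AD(2-5) v] by simp
    qed
    have D_1: "s1 ''D'' (l v) = 1 \<longleftrightarrow> v \<notin> f ` A" if v: "v \<in> insert r (\<Union>A)" for v
      using D[OF v] AD(2) by auto
    have row: "edge q \<subseteq> insert r (\<Union>A)" if "q \<in> A" for q using that AD(6) by auto
    have less: "l v < n" if "v \<in> edge q" "q \<in> A" for v q
      using that row VA l_less by blast
    have br: "branches (M j) (s1 ''D'') n = l ` (edge (ps ! j) \<inter> f ` A)"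
      if j: "j < m" "ps ! j \<in> A" for j
    proof
      show "branches (M j) (s1 ''D'') n \<subseteq> l ` (edge (ps ! j) \<inter> f ` A)"
      proof
        fix i assume "i \<in> branches (M j) (s1 ''D'') n"
        then have i: "i < n" "M j i = 1" "s1 ''D'' i \<noteq> 1" by (auto simp: branches_def)
        then obtain v where v: "v \<in> edge (ps ! j)" "i = l v"
          using M_1(1)[OF j(1)] by blast
        have "v \<in> insert r (\<Union>A)" using row[OF j(2)] v(1) by (rule subsetD)
        then have "v \<in> f ` A" using i(3) D_1 unfolding v(2) by metis
        with v show "i \<in> l ` (edge (ps ! j) \<inter> f ` A)" by blast
      qed
      show "l ` (edge (ps ! j) \<inter> f ` A) \<subseteq> branches (M j) (s1 ''D'') n"
      proof
        fix i assume "i \<in> l ` (edge (ps ! j) \<inter> f ` A)"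
        then obtain v where v: "v \<in> edge (ps ! j)" "v \<in> f ` A" "i = l v" by blast
        have "v \<in> insert r (\<Union>A)" using row[OF j(2)] v(1) by (rule subsetD)
        then have "s1 ''D'' i \<noteq> 1" using v(2) D_1 unfolding v(3) by metis
        moreover have "i < n" using less[OF v(1) j(2)] v(3) by simp
        moreover have "i \<in> l ` edge (ps ! j)" unfolding v(3) using v(1) by (rule imageI)
        then have "M j i = 1" using M[OF j(1) \<open>i < n\<close>] j(2) by simp
        ultimately show "i \<in> branches (M j) (s1 ''D'') n" by (simp add: branches_def)
      qed
    qed
    have leg: "top_leg (M j) (s1 ''D'') n = Suc (key q)"
      if j: "j < m" "ps ! j = q" "q \<in> leaves f A" for j q
    proof -
      have q: "q \<in> A" "q \<inter> f ` A = {}" using j by (auto simp: leaves_def)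
      have "{i. i < n \<and> M j i = 1 \<and> s1 ''D'' i = 1} = l ` q"
      proof
        show "{i. i < n \<and> M j i = 1 \<and> s1 ''D'' i = 1} \<subseteq> l ` q"
        proof
          fix i assume "i \<in> {i. i < n \<and> M j i = 1 \<and> s1 ''D'' i = 1}"
          then have i: "i < n" "M j i = 1" "s1 ''D'' i = 1" by auto
          then obtain v where v: "v \<in> edge q" "i = l v"
            using M_1(1)[OF j(1)] j(2) by blast
          have "v \<in> insert r (\<Union>A)" using row[OF q(1)] v(1) by (rule subsetD)
          then have "v \<notin> f ` A" using i(3) D_1 unfolding v(2) by metis
          with v q(1) show "i \<in> l ` q" by auto
        qed
        show "l ` q \<subseteq> {i. i < n \<and> M j i = 1 \<and> s1 ''D'' i = 1}"
        proof
          fix i assume "i \<in> l ` q"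
          then obtain v where v: "v \<in> q" "i = l v" by blast
          have "i < n" using less[of v q] v q(1) by simp
          moreover have "v \<in> insert r (\<Union>A)" "v \<notin> f ` A" using v(1) q by auto
          then have "s1 ''D'' i = 1" using D_1 unfolding v(2) by metis
          moreover have "i \<in> l ` edge (ps ! j)" unfolding j(2) v(2) using v(1) by blast
          then have "M j i = 1" using M[OF j(1) \<open>i < n\<close>] j(2) q(1) by simp
          ultimately show "i \<in> {i. i < n \<and> M j i = 1 \<and> s1 ''D'' i = 1}" by simp
        qed
      qed
      moreover have "Max (insert 0 (Suc ` l ` q)) = Suc (key q)"
      proof (rule Max_eqI)
        have qP: "q \<in> P" using q AD(1) by blast
        show "finite (insert 0 (Suc ` l ` q))" using finite_part[OF qP] by simp
        show "Suc (key q) \<in> insert 0 (Suc ` l ` q)" using key_in[OF qP] by simp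
        show "y \<le> Suc (key q)" if "y \<in> insert 0 (Suc ` l ` q)" for y
          using that finite_part[OF qP] by (auto simp: key_def)
      qed
      ultimately show ?thesis by (simp add: top_leg_def)
    qed
    have J_branch: "branches (M J) (s1 ''D'') n = {l (f p)}"
    proof -
      have "edge p \<inter> f ` A = {f p}" using pL by (auto simp: leaves_def)
      moreover have "branches (M J) (s1 ''D'') n = l ` (edge (ps ! J) \<inter> f ` A)"
        by (rule br[OF J(1)]) (simp add: J(2) pA)
      ultimately show ?thesis unfolding J(2) by (simp only: image_insert image_empty)
    qed
    \<comment> \<open>A competing row with a single branch belongs to a leaf: the branch is the
      parent of its own part, so no parent lies in the part.\<close>
    have top: "top_leg (M j) (s1 ''D'') n < top_leg (M J) (s1 ''D'') n"
      if j: "j < m" "j \<noteq> J" "card (branches (M j) (s1 ''D'') n) = 1" for j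
    proof -
      let ?q = "ps ! j"
      have "branches (M j) (s1 ''D'') n \<noteq> {}" using j(3) by auto
      then have q: "?q \<in> A" using M_1(2)[OF j(1)] unfolding branches_def by blast
      have "card (edge ?q \<inter> f ` A) = 1"
      proof -
        have "inj_on l (edge ?q \<inter> f ` A)"
          by (rule inj_on_subset[OF inj_l]) (use row[OF q] VA in blast)
        then show ?thesis using j(3) unfolding br[OF j(1) q] by (simp only: card_image)
      qed
      then obtain x where "edge ?q \<inter> f ` A = {x}" by (rule card_1_singletonE)
      moreover have "f ?q \<in> edge ?q \<inter> f ` A" using q by blast
      ultimately have only: "edge ?q \<inter> f ` A = {f ?q}" by (metis singletonD)
      have "f q' \<notin> ?q" if "q' \<in> A" for q'
      proof
        assume "f q' \<in> ?q"
        then have "f q' \<in> edge ?q \<inter> f ` A" using that by simp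
        then have "f q' = f ?q" unfolding only by (rule singletonD)
        then show False using \<open>f q' \<in> ?q\<close> AD(5) q by simp
      qed
      then have "?q \<in> leaves f A" using q unfolding leaves_def by simp
      moreover have "?q \<noteq> p" using j J ps(1) nth_eq_iff_index_eq by metis
      ultimately have "key ?q < key p" using top_leaf(2)[OF A] p by simp
      then show ?thesis using leg[OF j(1) refl \<open>?q \<in> leaves f A\<close>] leg[OF J pL] by simp
    qed
    have sel: "run n select s1 (\<lambda>s'.
      agree {''i'', ''j'', ''q'', ''a'', ''c'', ''p'', ''b'', ''s'', ''w''} s1 s' \<and>
      s' ''s'' 0 = 4 + J * n \<and> s' ''w'' 0 = l (f p))"
      by (rule run_select[of s1 n m M J "l (f p)"])
        (use n m length_le J(1) i1 J_branch leg[OF J pL] top in \<open>auto simp: M_def\<close>)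
    show "run n (Seq select remove_edge) s1 (\<lambda>s'. stores (A - {p}) s' \<and>
      s' ''t'' = s ''t'' \<and> s' ''output'' = (s ''output'')(s ''t'' 0 + 1 := l (f p)))"
    proof (rule run_Seq, rule run_mono[OF sel], elim conjE)
      fix s2 assume
        a2: "agree {''i'', ''j'', ''q'', ''a'', ''c'', ''p'', ''b'', ''s'', ''w''} s1 s2"
        and s2: "s2 ''s'' 0 = 4 + J * n" "s2 ''w'' 0 = l (f p)"
      have i2: "s2 ''input'' = s ''input''" "s2 ''output'' = s ''output''" "s2 ''t'' = s ''t''"
        using a2 i1 by (simp_all add: agree_def)
      have n2: "s2 ''input'' 1 = n" and o2: "4 \<le> s2 ''s'' 0" using i2 n s2 by simp_all
      show "run n remove_edge s2 (\<lambda>s'. stores (A - {p}) s' \<and>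
        s' ''t'' = s ''t'' \<and> s' ''output'' = (s ''output'')(s ''t'' 0 + 1 := l (f p)))"
      proof (rule run_mono[OF run_remove_edge[of s2 n, OF n2 o2]], elim conjE)
        fix s3 assume a3: "agree {''i'', ''input'', ''output''} s2 s3"
          and in3: "s3 ''input'' = (\<lambda>x. if s2 ''s'' 0 \<le> x \<and> x < s2 ''s'' 0 + n then 0
            else s2 ''input'' x)"
          and out3: "s3 ''output'' = (s2 ''output'')(s2 ''t'' 0 + 1 := s2 ''w'' 0)"
        have cell: "s3 ''input'' (4 + j * n + i) =
            of_bool (ps ! j \<in> A - {p} \<and> i \<in> l ` edge (ps ! j))" if ji: "j < m" "i < n" for j i
        proof (cases "j = J")
          case True
          then show ?thesis using in3 s2 ji J by simp
        next
          case False
          \<comment> \<open>Different rows are disjoint blocks of length \<open>n\<close>, so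
            clearing row \<open>J\<close> does not touch row \<open>j\<close>.\<close>
          have "\<not> (J * n \<le> j * n + i \<and> j * n + i < J * n + n)"
          proof
            assume *: "J * n \<le> j * n + i \<and> j * n + i < J * n + n"
            have "j * n < (J + 1) * n" "J * n < (j + 1) * n" using * ji by auto
            then have "j < J + 1" "J < j + 1" by (auto simp only: mult_less_cancel2)
            then show False using False by simp
          qed
          moreover have "ps ! j \<noteq> p" using False ji J ps(1) nth_eq_iff_index_eq by metis
          ultimately show ?thesis using in3 s2 i2 M[OF ji] by (auto simp: M_def)
        qed
        have "s3 ''input'' 1 = n" "s3 ''input'' 2 = l r" "s3 ''input'' 3 = m"
          using in3 s2 i2 n m r by simp_all
        then have "stores (A - {p}) s3" using cell by (simp add: stores_def)
        moreover have "s3 ''t'' = s ''t''" using a3 i2 by (simp add: agree_def)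
        ultimately show "stores (A - {p}) s3 \<and> s3 ''t'' = s ''t'' \<and>
          s3 ''output'' = (s ''output'')(s ''t'' 0 + 1 := l (f p))"
          using out3 i2 s2 by simp
      qed
    qed
  qed
qed

lemma run_pruefer:
  assumes s: "stores P s" and m: "0 < m"
  shows "run n pruefer s (\<lambda>s'. holds_list (s' ''output'') (map l (code key f P (m - 1))))"
  unfolding pruefer_def
proof (rule run_Seq, rule run_Assign)
  \<comment> \<open>The letters \<open>w\<close> written so far, followed by the code of the parts
    still present, form the complete code. After \<open>m - 1\<close> rounds one part is left and
    its code is empty.\<close>
  let ?I = "\<lambda>t s'. \<exists>A w. alive A \<and> card A = m - t \<and> stores A s' \<and> s' ''output'' 0 = m - 1 \<and>
    length w = t \<and> (\<forall>i<t. s' ''output'' (i + 1) = l (w ! i)) \<and>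
    code key f P (m - 1) = w @ code key f A (m - 1 - t)"
  have edges: "s ''input'' 3 = m" using s by (simp add: stores_def)
  have cP: "card P = m" using ps distinct_card by fastforce
  show "run n (for_loop ''t'' (Minus edge_count (Const 1)) (Seq degrees (Seq select remove_edge)))
     (s(''output'' := (s ''output'')
       (aval (Const 0) s := aval (Minus edge_count (Const 1)) s)))
     (\<lambda>s'. holds_list (s' ''output'') (map l (code key f P (m - 1))))"
  proof (rule run_for[where N = "m - 1" and I = ?I])
    show "m - 1 \<le> n" using length_le by simp
    have "alive P" using f m ps by (auto simp: alive_def parent_maps_def PiE_restrict)
    then show "?I 0 ((s(''output'' := (s ''output'')
       (aval (Const 0) s := aval (Minus edge_count (Const 1)) s)))(''t'' :=
         ((s(''output'' := (s ''output'')
       (aval (Const 0) s := aval (Minus edge_count (Const 1)) s))) ''t'')(0 := 0)))"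
      using s edges cP by (intro exI[of _ P] exI[of _ "[]"]) (auto simp: stores_def)
  next
    fix t s' assume t: "t < m - 1" "?I t s'" "s' ''t'' 0 = t"
    then obtain A w where A: "alive A" "card A = m - t" "stores A s'" "s' ''output'' 0 = m - 1"
      "length w = t" "\<forall>i<t. s' ''output'' (i + 1) = l (w ! i)"
      "code key f P (m - 1) = w @ code key f A (m - 1 - t)" by blast
    define p where "p = top_part key (leaves f A)"
    have pA: "p \<in> A" using top_leaf(1)[OF A(1)] by (simp add: p_def leaves_def)
    have cA: "card (A - {p}) = m - Suc t" using pA A(2) aliveD(2)[OF A(1)] by simp
    then have "0 < card (A - {p})" using t(1) by simp
    then have "A - {p} \<noteq> {}" by (metis card.empty less_irrefl)
    then have aA: "alive (A - {p})" using alive_remove[OF A(1)] by (simp add: p_def)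
    have "m - 1 - t = Suc (m - 1 - Suc t)" using t(1) by simp
    then have cd: "code key f A (m - 1 - t) = f p # code key f (A - {p}) (m - 1 - Suc t)"
      by (simp add: p_def Let_def)
    show "run n (Seq degrees (Seq select remove_edge)) s'
      (\<lambda>s'. s' ''t'' 0 = t \<and> ?I (Suc t) (s'(''t'' := (s' ''t'')(0 := Suc t))))"
    proof (rule run_mono[OF run_round[OF A(1,3) p_def]], elim conjE)
      fix s'' assume s'': "stores (A - {p}) s''" "s'' ''t'' = s' ''t''"
        "s'' ''output'' = (s' ''output'')(s' ''t'' 0 + 1 := l (f p))"
      have "\<forall>i<Suc t. s'' ''output'' (i + 1) = l ((w @ [f p]) ! i)"
        using A(5,6) s''(3) t(3) by (auto simp: nth_append less_Suc_eq)
      then have "?I (Suc t) (s''(''t'' := (s'' ''t'')(0 := Suc t)))"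
        using aA cA s'' A cd t(3)
        by (intro exI[of _ "A - {p}"] exI[of _ "w @ [f p]"]) (auto simp: stores_def)
      then show "s'' ''t'' 0 = t \<and> ?I (Suc t) (s''(''t'' := (s'' ''t'')(0 := Suc t)))"
        using s''(2) t(3) by simp
    qed
  next
    fix t s' assume "?I t s'"
    then show "aval (Minus edge_count (Const 1)) s' = m - 1" by (auto simp: stores_def)
  next
    fix s' assume "?I (m - 1) s'"
    then show "holds_list (s' ''output'') (map l (code key f P (m - 1)))"
      by (auto simp: holds_list_def)
  qed
qed

end

lemma outputs_within_run:
  assumes "run n c (initial_memory xs) (\<lambda>s. holds_list (s ''output'') ys)"
  shows "outputs_within c xs ys (poly (cost_poly c) n)"
  using assms unfolding outputs_within_def run_def by blast

context numbered_tree
begin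

text \<open>Cell 0 holds the length and three header entries follow, so the matrix starts in cell 4,
  the initial value of \<open>q\<close>.\<close>

lemma stores_initial:
  "stores P (initial_memory (encode_hypertree l n r (map edge ps)))"
proof -
  let ?h = "\<lambda>e. map (\<lambda>i. if i \<in> l ` e then 1 else 0 :: nat) [0..<n]"
  let ?R = "concat (map ?h (map edge ps))"
  let ?xs = "encode_hypertree l n r (map edge ps)"
  have xs: "?xs = [n, l r, m] @ ?R" by (simp add: encode_hypertree_def)
  have len: "length ?R = m * n"
    using length_concat_rows[of "map edge ps" ?h n] by simp
  have "initial_memory ?xs ''input'' (4 + j * n + i) = of_bool (ps ! j \<in> P \<and> i \<in> l ` edge (ps ! j))"
    if ji: "j < m" "i < n" for j i
  proof -
    have "j * n + i < (j + 1) * n" using ji by simp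
    also have "\<dots> \<le> m * n" using ji by (intro mult_right_mono) auto
    finally have "initial_memory ?xs ''input'' (4 + j * n + i) = ?R ! (j * n + i)"
      unfolding xs initial_memory_def using len by (simp add: numeral_eq_Suc)
    also have "\<dots> = ?h (edge (ps ! j)) ! i"
      using nth_concat_rows[of "map edge ps" ?h n j i] ji by simp
    also have "\<dots> = of_bool (ps ! j \<in> P \<and> i \<in> l ` edge (ps ! j))"
      using ji ps(2) by (auto simp: of_bool_def)
    finally show ?thesis .
  qed
  moreover have "initial_memory ?xs ''input'' 1 = n" "initial_memory ?xs ''input'' 2 = l r"
    "initial_memory ?xs ''input'' 3 = m"
    unfolding xs initial_memory_def by (simp_all add: numeral_eq_Suc)
  ultimately show ?thesis by (simp add: stores_def)
qed

end

theorem theorem4p1: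
  "\<exists>(c :: com) (p :: nat poly).
     \<forall>(V :: 'a set) (r :: 'a) (P :: 'a set set) (k :: nat) (l :: 'a \<Rightarrow> nat).
       finite V \<and> r \<in> V \<and> partition_on (V - {r}) P \<and> card P = k \<and> k \<ge> 1 \<and>
       bij_betw l V {..<card V} \<longrightarrow>
       (\<exists>\<Phi> :: 'a set set \<Rightarrow> 'a list.
          bij_betw \<Phi> (rooted_hypertrees V r P) (words V (k - 1)) \<and>
          (\<forall>T \<in> rooted_hypertrees V r P. \<forall>v \<in> V - {r}.
             int (count_list (\<Phi> T) v) = int (hdegree T v) - 1) \<and>
          computes_within c V r l (rooted_hypertrees V r P) \<Phi> (poly p (card V)))"
proof (rule exI[of _ pruefer], rule exI[of _ "cost_poly pruefer"], intro allI impI, elim conjE)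
  fix V :: "'a set" and r :: 'a and P :: "'a set set" and k :: nat and l :: "'a \<Rightarrow> nat"
  assume V: "finite V" "r \<in> V" and P: "partition_on (V - {r}) P" and k: "card P = k" "1 \<le> k"
    and l: "bij_betw l V {..<card V}"
  let ?T = "rooted_hypertrees V r P" and ?F = "parent_maps r P"
  let ?key = "\<lambda>p. Max (l ` p)"
  have parts: "disjoint P" "{} \<notin> P" "\<Union>P = V - {r}" using P by (auto simp: partition_on_def)
  have finP: "finite P" using k by (intro card_ge_0_finite) simp
  have cP: "card P = Suc (k - 1)" using k by simp
  have U: "insert r (\<Union>P) = V" "r \<notin> \<Union>P" using parts(3) V by auto
  obtain ps where ps: "distinct ps" "set ps = P" using finite_distinct_list[OF finP] by blast
  have tree: "numbered_tree V r P l f qs" if "f \<in> ?F" "distinct qs" "set qs = P" for f qs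
    using V P l that by unfold_locales
  \<comment> \<open>The star is a parent map for every \<open>P\<close>. It serves to instantiate
    the locale and obtain the injectivity of the key, which does not depend on the map.\<close>
  have "(\<lambda>p\<in>P. r) \<in> ?F" using parts(3)
    by (auto simp: parent_maps_def intro!: exI[of _ "\<lambda>v. of_bool (v \<noteq> r)"])
  note star = tree[OF this ps]
  have inj_key: "inj_on ?key P"
    using numbered_tree.inj_key[OF star] numbered_tree.key_def[OF star] by (simp add: inj_on_def)
  define parents where "parents = inv_into ?F (attach P)"
  define \<Phi> where "\<Phi> E = code ?key (parents E) P (k - 1)" for E
  note bij = bij_attach[OF V P]
  have parents: "parents E \<in> ?F" "attach P (parents E) = E" if "E \<in> ?T" for E
    using that bij by (auto simp: parents_def bij_betw_def inv_into_into f_inv_into_f)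
  have "bij_betw \<Phi> ?T (words V (k - 1))"
  proof -
    have "bij_betw (\<lambda>f. code ?key f P (k - 1)) ?F (words V (k - 1))"
      using bij_code[OF finP cP inj_key parts(1) U(2)] U(1) by simp
    from bij_betw_trans[OF bij_betw_inv_into[OF bij] this]
    show ?thesis unfolding \<Phi>_def parents_def comp_def .
  qed
  moreover have "int (count_list (\<Phi> E) v) = int (hdegree E v) - 1"
    if E: "E \<in> ?T" and v: "v \<in> V - {r}" for E v
  proof -
    have "count_list (\<Phi> E) v = card {q \<in> P. parents E q = v}"
      unfolding \<Phi>_def using parents(1)[OF E] inj_key v parts
      by (intro count_code[OF finP cP _ _ _ U(2)]) auto
    moreover have "hdegree E v = card {q \<in> P. parents E q = v} + 1"
      using hdegree_attach[OF parents(1)[OF E] parts(1,2) finP, of v] v parts(3) parents(2)[OF E]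
      by simp
    ultimately show ?thesis by simp
  qed
  moreover have "computes_within pruefer V r l ?T \<Phi> (poly (cost_poly pruefer) (card V))"
    unfolding computes_within_def
  proof (intro ballI allI impI, elim conjE)
    fix E es assume E: "E \<in> ?T" and es: "distinct es" "set es = E"
    let ?f = "parents E"
    let ?e = "\<lambda>p. insert (?f p) p"
    have b: "bij_betw ?e P E"
      using inj_on_attach_edge[OF parents(1)[OF E] parts(1,2)] parents(2)[OF E]
      by (simp add: bij_betw_def attach_def)
    \<comment> \<open>The parts are listed in the order of the given \<open>es\<close>, so that the
      locale describes exactly this input.\<close>
    define qs where "qs = map (inv_into P ?e) es"
    have "distinct qs" "set qs = P"
      using es bij_betw_inv_into[OF b] by (auto simp: qs_def distinct_map bij_betw_def)
    moreover have "?e (inv_into P ?e e) = e" if "e \<in> set es" for e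
      using that es(2) by (intro bij_betw_inv_into_right[OF b]) simp
    then have "map ?e qs = es" unfolding qs_def map_map by (intro map_idI) simp
    ultimately have qs: "distinct qs" "set qs = P" "map ?e qs = es" by simp_all
    interpret numbered_tree V r P l ?f qs by (rule tree[OF parents(1)[OF E] qs(1,2)])
    have "length qs = k" using qs distinct_card k by fastforce
    then have "run (card V) pruefer (initial_memory (encode_hypertree l (card V) r es))
        (\<lambda>s'. holds_list (s' ''output'') (map l (code key ?f P (k - 1))))"
      using run_pruefer[OF stores_initial] k(2) unfolding qs(3) by simp
    moreover have "key = ?key" by (simp add: key_def fun_eq_iff)
    ultimately show "outputs_within pruefer (encode_hypertree l (card V) r es) (map l (\<Phi> E))
        (poly (cost_poly pruefer) (card V))"
      unfolding \<Phi>_def by (intro outputs_within_run) simp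
  qed
  ultimately show "\<exists>\<Phi> :: 'a set set \<Rightarrow> 'a list.
      bij_betw \<Phi> ?T (words V (k - 1)) \<and>
      (\<forall>T \<in> ?T. \<forall>v \<in> V - {r}. int (count_list (\<Phi> T) v) = int (hdegree T v) - 1) \<and>
      computes_within pruefer V r l ?T \<Phi> (poly (cost_poly pruefer) (card V))"
    by blast
qed

end
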